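(* Let $c\in\mathbb{R}$, $c\neq 0$. The critical point $(0,0)$ of the planar system $$\dot x = y,\qquad \dot y = -c x^{2}$$ is a cusp.
   Context: A critical point $p$ of an analytic planar vector field is a cusp if it is isolated and its local phase portrait consists of exactly two hyperbolic sectors, separated by exactly two separatrices: one orbit tending to $p$ as $t\to+\infty$ and one orbit tending to $p$ as $t\to-\infty$, both tangent at $p$ to the same half-line. *)

theory Defs
  imports "HOL-Analysis.Analysis"
begin

type_synonym plane = "real \<times> real"

text \<open>Analyticity is local representability by a convergent double power series.\<close>

definition analytic_field :: "(plane \<Rightarrow> plane) \<Rightarrow> bool" where
  "analytic_field X \<longleftrightarrow>
     (\<forall>x0 y0. \<exists>a :: nat \<Rightarrow> nat \<Rightarrow> plane. \<exists>r>0. \<forall>u v. \<bar>u\<bar> < r \<and> \<bar>v\<bar> < r \<longrightarrow>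
        ((\<lambda>(i, j). (u ^ i * v ^ j) *\<^sub>R a i j) has_sum X (x0 + u, y0 + v)) UNIV)"

definition isolated_critical_point :: "(plane \<Rightarrow> plane) \<Rightarrow> plane \<Rightarrow> bool" where
  "isolated_critical_point X p \<longleftrightarrow> X p = 0 \<and> (\<forall>\<^sub>F q in at p. X q \<noteq> 0)"

definition integral_curve :: "(plane \<Rightarrow> plane) \<Rightarrow> real set \<Rightarrow> (real \<Rightarrow> plane) \<Rightarrow> bool" where
  "integral_curve X J \<phi> \<longleftrightarrow>
     is_interval J \<and> (\<forall>t\<in>J. (\<phi> has_vector_derivative X (\<phi> t)) (at t within J))"

text \<open>The point \<open>w\<close> lies on the orbit arc of \<open>z\<close> inside \<open>S\<close>, not before \<open>z\<close>.
  This relation records the orbit arcs in \<open>S\<close> together with their orientation, but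
  not their parametrisation by time.\<close>

definition flows_within :: "(plane \<Rightarrow> plane) \<Rightarrow> plane set \<Rightarrow> plane \<Rightarrow> plane \<Rightarrow> bool" where
  "flows_within X S z w \<longleftrightarrow>
     (\<exists>T \<phi>. 0 \<le> T \<and> integral_curve X {0..T} \<phi> \<and> \<phi> ` {0..T} \<subseteq> S \<and> \<phi> 0 = z \<and> \<phi> T = w)"

text \<open>A homeomorphism carrying orbit arcs to orbit arcs and preserving their orientation.\<close>

definition orbital_equivalence ::
  "(plane \<Rightarrow> plane) \<Rightarrow> plane set \<Rightarrow> (plane \<Rightarrow> plane) \<Rightarrow> plane set \<Rightarrow> (plane \<Rightarrow> plane) \<Rightarrow> bool" where
  "orbital_equivalence X S Y T h \<longleftrightarrow>
     (\<exists>k. homeomorphism S T h k) \<and>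
     (\<forall>z\<in>S. \<forall>w\<in>S. flows_within X S z w \<longleftrightarrow> flows_within Y T (h z) (h w))"

definition saddle :: "plane \<Rightarrow> plane" where
  "saddle = (\<lambda>(u, v). (u, - v))"

text \<open>A hyperbolic sector at \<open>p\<close> is a closed sector orbitally equivalent to a closed
  quadrant of the linear saddle, cut off at the sides \<open>v = 1\<close> and \<open>u = 1\<close> of the unit
  square. Its boundary separatrices are the images of the two axes: \<open>A\<close> is the incoming
  one and \<open>B\<close> the outgoing one, both without the vertex \<open>p\<close>.\<close>

definition hyperbolic_sector ::
  "(plane \<Rightarrow> plane) \<Rightarrow> plane \<Rightarrow> plane set \<Rightarrow> plane set \<Rightarrow> plane set \<Rightarrow> bool" where
  "hyperbolic_sector X p S A B \<longleftrightarrow>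
     (\<exists>h. orbital_equivalence saddle ({0..1} \<times> {0..1}) X S h \<and> h (0, 0) = p \<and>
          h ` ({0} \<times> {0<..1}) = A \<and> h ` ({0<..1} \<times> {0}) = B)"

text \<open>The notion is local, so separatrices are semi-orbits: \<open>\<alpha>\<close> is a positive one tending
  to \<open>p\<close> as \<open>t \<rightarrow> +\<infinity>\<close>, \<open>\<beta>\<close> a negative one tending to \<open>p\<close> as \<open>t \<rightarrow> -\<infinity>\<close>. (Globally both
  may belong to the same homoclinic orbit.) The last two conditions say that there are no
  other orbits tending to \<open>p\<close>. The two separatrices are tangent at \<open>p\<close> to the half-line
  from \<open>p\<close> in the direction \<open>d\<close>.\<close>

definition cusp :: "(plane \<Rightarrow> plane) \<Rightarrow> plane \<Rightarrow> bool" where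
  "cusp X p \<longleftrightarrow>
     analytic_field X \<and> isolated_critical_point X p \<and>
     (\<exists>\<alpha> \<beta> S1 S2 d.
        integral_curve X {0..} \<alpha> \<and> (\<alpha> \<longlongrightarrow> p) at_top \<and>
        integral_curve X {..0} \<beta> \<and> (\<beta> \<longlongrightarrow> p) at_bot \<and>
        ((\<lambda>t. sgn (\<alpha> t - p)) \<longlongrightarrow> d) at_top \<and>
        ((\<lambda>t. sgn (\<beta> t - p)) \<longlongrightarrow> d) at_bot \<and>
        hyperbolic_sector X p S1 (\<alpha> ` {0..}) (\<beta> ` {..0}) \<and>
        hyperbolic_sector X p S2 (\<alpha> ` {0..}) (\<beta> ` {..0}) \<and>
        S1 \<inter> S2 = {p} \<union> \<alpha> ` {0..} \<union> \<beta> ` {..0} \<and>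
        p \<in> interior (S1 \<union> S2) \<and>
        (\<forall>\<phi>. integral_curve X {0..} \<phi> \<and> (\<forall>t\<ge>0. \<phi> t \<noteq> p) \<and> (\<phi> \<longlongrightarrow> p) at_top \<longrightarrow>
             (\<forall>\<^sub>F t in at_top. \<phi> t \<in> \<alpha> ` {0..})) \<and>
        (\<forall>\<phi>. integral_curve X {..0} \<phi> \<and> (\<forall>t\<le>0. \<phi> t \<noteq> p) \<and> (\<phi> \<longlongrightarrow> p) at_bot \<longrightarrow>
             (\<forall>\<^sub>F t in at_bot. \<phi> t \<in> \<beta> ` {..0})))"

end

theory Submission
  imports Defs "HOL-Real_Asymp.Real_Asymp"
begin

text \<open>Scaling the plane by \<open>a = -3 / (2c)\<close> turns the system into \<open>x' = y\<close>, \<open>y' = 3/2 x\<^sup>2\<close>, with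
  first integral \<open>s = x\<^sup>3 - y\<^sup>2\<close>. Since the real cube root is a homeomorphism, \<open>(s, y)\<close> are
  global coordinates of the plane, in which the orbits are the horizontal lines
  \<open>s = const\<close> directed by increasing \<open>y\<close>, the line \<open>s = 0\<close> being broken at the equilibrium.
  The saddle on the unit square has the same description in the coordinates
  \<open>(uv, u - v)\<close>. Hence each of the regions \<open>s \<ge> 0\<close> and \<open>s \<le> 0\<close> contributes one hyperbolic
  sector, and the separatrices are the two branches of \<open>y\<^sup>2 = x\<^sup>3\<close>.\<close>

section \<open>Orbit arcs\<close>

text \<open>The obstacle is that the coordinates (s, y) are only topological. The cube root is not
  differentiable at 0, and y' = 3/2 x^2 vanishes on the line x = 0, so an orbit with s < 0 is not
  regularly parametrised by y where it crosses that line. Orbital equivalence asks only for a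
  homeomorphism that respects arcs and their orientation, hence no smooth conjugacy is sought. Both
  flows are compared with one relation on pairs (s, y), \<open>orbit_le\<close>, and arcs are built
  by regular changes of parameter: by y away from x = 0, by x across it. That no arc crosses the
  equilibrium needs uniqueness at that single point only, which a Gronwall estimate supplies. The
  coefficient 3/2 is chosen so that x^3 - y^2 is conserved without further constants.\<close>

lemma flows_within_trans:
  assumes "flows_within X S z w" "flows_within X S w q"
  shows "flows_within X S z q"
proof -
  obtain T \<phi> where T: "0 \<le> T" and \<phi>: "integral_curve X {0..T} \<phi>" "\<phi> ` {0..T} \<subseteq> S" "\<phi> 0 = z" "\<phi> T = w"
    using assms(1) unfolding flows_within_def by blast
  obtain U \<psi> where U: "0 \<le> U" and \<psi>: "integral_curve X {0..U} \<psi>" "\<psi> ` {0..U} \<subseteq> S" "\<psi> 0 = w" "\<psi> U = q"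
    using assms(2) unfolding flows_within_def by blast
  define \<xi> where "\<xi> t = (if t \<in> {0..T} then \<phi> t else \<psi> (t - T))" for t
  have conn: "{0..T} \<inter> {T..T + U} = {T}"
    using T U by auto
  have shift: "((\<lambda>t. \<psi> (t - T)) has_vector_derivative X (\<psi> (t - T))) (at t within {T..T + U})"
    if "t \<in> {T..T + U}" for t
  proof -
    have "((\<lambda>s. s - T) has_vector_derivative 1) (at t within {T..T + U})"
      by (auto intro!: derivative_eq_intros)
    moreover have "(\<lambda>s. s - T) ` {T..T + U} = {0..U}"
      by (force simp: image_iff intro: bexI[of _ "_ + T"])
    then have "(\<psi> has_vector_derivative X (\<psi> (t - T))) (at (t - T) within (\<lambda>s. s - T) ` {T..T + U})"
      using \<psi>(1) that unfolding integral_curve_def by auto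
    ultimately show ?thesis
      using vector_diff_chain_within[of "\<lambda>s. s - T" 1 t "{T..T + U}" \<psi>] by (simp add: o_def)
  qed
  have "(\<xi> has_vector_derivative X (\<xi> t)) (at t within {0..T + U})" if t: "t \<in> {0..T + U}" for t
  proof -
    have "((\<lambda>t. if t \<in> {0..T} then \<phi> t else \<psi> (t - T)) has_vector_derivative
        (if t \<in> {0..T} then X (\<phi> t) else X (\<psi> (t - T)))) (at t within {0..T + U})"
    \<comment> \<open>The pieces overlap only at \<open>T\<close>, where both one-sided derivatives
      are the value of \<open>X\<close> at the common point \<open>w\<close>, so the joint has no
      corner.\<close>
    proof (rule has_vector_derivative_If_within_closures[where T = "{T..T + U}"])
      show "t \<in> {0..T} \<union> {T..T + U}" "{0..T + U} = {0..T} \<union> {T..T + U}"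
        using t T U by auto
    next
      assume "t \<in> {0..T} \<union> (closure {0..T} \<inter> closure {T..T + U})"
      then have "t \<in> {0..T}" using T by auto
      then show "(\<phi> has_vector_derivative X (\<phi> t))
          (at t within {0..T} \<union> (closure {0..T} \<inter> closure {T..T + U}))"
        using \<phi>(1) T U conn unfolding integral_curve_def by (auto simp: insert_absorb)
    next
      assume "t \<in> {T..T + U} \<union> (closure {0..T} \<inter> closure {T..T + U})"
      then have "t \<in> {T..T + U}" using U by auto
      then show "((\<lambda>t. \<psi> (t - T)) has_vector_derivative X (\<psi> (t - T)))
          (at t within {T..T + U} \<union> (closure {0..T} \<inter> closure {T..T + U}))"
        using shift T U conn by (auto simp: insert_absorb)
    next
      assume "t \<in> closure {0..T}" "t \<in> closure {T..T + U}"
      then have [simp]: "t = T" by auto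
      show "\<phi> t = \<psi> (t - T)" "X (\<phi> t) = X (\<psi> (t - T))"
        using \<phi> \<psi> by auto
    qed
    then show ?thesis unfolding \<xi>_def by (simp add: if_distrib cong: if_cong)
  qed
  then have "integral_curve X {0..T + U} \<xi>"
    unfolding integral_curve_def by (simp add: is_interval_cc)
  moreover have "\<xi> ` {0..T + U} \<subseteq> S"
  proof
    fix p assume "p \<in> \<xi> ` {0..T + U}"
    then obtain t where t: "t \<in> {0..T + U}" "p = \<xi> t" by auto
    show "p \<in> S"
      using t \<phi>(2) \<psi>(2) unfolding \<xi>_def by (cases "t \<le> T") (auto simp: image_subset_iff)
  qed
  moreover have "\<xi> 0 = z" "\<xi> (T + U) = q"
    using \<phi> \<psi> T U unfolding \<xi>_def by auto
  ultimately show ?thesis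
    unfolding flows_within_def using T U by (intro exI[of _ "T + U"] exI[of _ \<xi>]) auto
qed

text \<open>Time 0 suffices: within a one-point interval every derivative is admissible, so the
  constant curve serves even where the field does not vanish.\<close>

lemma flows_within_refl:
  assumes "z \<in> S"
  shows "flows_within X S z z"
  unfolding flows_within_def integral_curve_def
  by (rule exI[of _ 0], rule exI[of _ "\<lambda>_. z"])
     (use assms is_interval_cc[of 0 "0::real"] in
       \<open>auto simp: has_vector_derivative_def has_derivative_within_singleton_iff bounded_linear_scaleR_left\<close>)

text \<open>Time along a curve with velocity \<open>\<lambda> \<cdot> X\<close> is the integral of \<open>\<lambda>\<close>.\<close>

lemma flows_within_reparametrize:
  assumes "a \<le> b"
    and deriv: "\<And>r. r \<in> {a..b} \<Longrightarrow> (\<gamma> has_vector_derivative l r *\<^sub>R X (\<gamma> r)) (at r within {a..b})"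
    and cont: "continuous_on {a..b} l" and pos: "\<And>r. r \<in> {a..b} \<Longrightarrow> 0 < l r"
    and S: "\<gamma> ` {a..b} \<subseteq> S"
  shows "flows_within X S (\<gamma> a) (\<gamma> b)"
proof -
  define \<tau> where "\<tau> r = integral {a..r} l" for r
  have \<tau>: "(\<tau> has_real_derivative l r) (at r within {a..b})" if "r \<in> {a..b}" for r
    unfolding \<tau>_def using integral_has_real_derivative[OF cont that] .
  have strict: "\<tau> r < \<tau> s" if "r \<in> {a..b}" "s \<in> {a..b}" "r < s" for r s
  proof -
    have "\<exists>x\<in>{r<..<s}. \<tau> s - \<tau> r = (\<lambda>h. l x * h) (s - r)"
    proof (rule mvt_simple[OF \<open>r < s\<close>])
      fix x assume "r \<le> x" "x \<le> s"
      then show "(\<tau> has_derivative (*) (l x)) (at x within {r..s})"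
        using \<tau>[of x] that unfolding has_field_derivative_def
        by (auto intro: has_derivative_subset)
    qed
    then obtain x where "x \<in> {r<..<s}" "\<tau> s - \<tau> r = l x * (s - r)" by auto
    then show ?thesis using pos[of x] that by (smt (verit) mult_pos_pos atLeastAtMost_iff greaterThanLessThan_iff)
  qed
  have inj: "inj_on \<tau> {a..b}"
    by (rule linorder_inj_onI') (use strict in force)
  have contt: "continuous_on {a..b} \<tau>"
    using \<tau> by (meson DERIV_continuous continuous_on_eq_continuous_within)
  define T where "T = \<tau> b"
  have \<tau>a: "\<tau> a = 0" by (simp add: \<tau>_def)
  have mono: "\<tau> r \<le> \<tau> s" if "r \<in> {a..b}" "s \<in> {a..b}" "r \<le> s" for r s
    using strict[OF that(1,2)] that(3) by (cases "r = s") auto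
  have img: "\<tau> ` {a..b} = {0..T}"
  proof
    show "\<tau> ` {a..b} \<subseteq> {0..T}"
      using mono[of a] mono[of _ b] \<open>a \<le> b\<close> by (auto simp: \<tau>a T_def)
    show "{0..T} \<subseteq> \<tau> ` {a..b}"
      using IVT'[of \<tau> a _ b] contt \<open>a \<le> b\<close> by (force simp: \<tau>a T_def)
  qed
  have "0 \<le> T" using mono[of a b] \<open>a \<le> b\<close> by (simp add: \<tau>a T_def)
  define \<rho> where "\<rho> = inv_into {a..b} \<tau>"
  have \<rho>\<tau>: "\<rho> (\<tau> r) = r" if "r \<in> {a..b}" for r
    unfolding \<rho>_def using inj that by (rule inv_into_f_f)
  have \<tau>\<rho>: "\<tau> (\<rho> t) = t" and \<rho>in: "\<rho> t \<in> {a..b}" if "t \<in> {0..T}" for t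
    using that unfolding img[symmetric] \<rho>_def by (rule f_inv_into_f, rule inv_into_into)
  have cont\<rho>: "continuous_on {0..T} \<rho>"
    using continuous_on_inv[OF contt compact_Icc, of \<rho>] \<rho>\<tau> by (simp add: img)
  have \<rho>: "(\<rho> has_real_derivative inverse (l (\<rho> t))) (at t within {0..T})" if t: "t \<in> {0..T}" for t
  proof -
    \<comment> \<open>The difference quotient of \<open>\<rho>\<close> is the inverse of that of
      \<open>\<tau>\<close>. To substitute into the limit, \<open>\<rho> s\<close> must approach
      \<open>\<rho> t\<close> without attaining it; limits within the interval cover the endpoints
      too.\<close>
    have "filterlim \<rho> (at (\<rho> t) within {a..b}) (at t within {0..T})"
    proof -
      have "(\<rho> \<longlongrightarrow> \<rho> t) (at t within {0..T})"
        using cont\<rho> t by (auto simp: continuous_on_def)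
      moreover have "\<forall>\<^sub>F s in at t within {0..T}. \<rho> s \<in> {a..b} \<and> \<rho> s \<noteq> \<rho> t"
        unfolding eventually_at_filter
        by (rule always_eventually) (metis \<tau>\<rho> \<rho>in t)
      ultimately show ?thesis by (simp add: filterlim_at)
    qed
    from filterlim_compose[OF \<tau>[OF \<rho>in[OF t], unfolded has_field_derivative_iff] this]
    have "((\<lambda>s. (\<tau> (\<rho> s) - \<tau> (\<rho> t)) / (\<rho> s - \<rho> t)) \<longlongrightarrow> l (\<rho> t)) (at t within {0..T})" .
    from tendsto_inverse[OF this] pos[OF \<rho>in[OF t]]
    have "((\<lambda>s. (\<rho> s - \<rho> t) / (\<tau> (\<rho> s) - \<tau> (\<rho> t))) \<longlongrightarrow> inverse (l (\<rho> t))) (at t within {0..T})"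
      by simp
    moreover have "\<forall>\<^sub>F s in at t within {0..T}.
        (\<rho> s - \<rho> t) / (\<tau> (\<rho> s) - \<tau> (\<rho> t)) = (\<rho> s - \<rho> t) / (s - t)"
      unfolding eventually_at_filter
      by (rule always_eventually) (simp add: \<tau>\<rho> t del: atLeastAtMost_iff)
    ultimately show ?thesis
      unfolding has_field_derivative_iff by (rule Lim_transform_eventually)
  qed
  have "integral_curve X {0..T} (\<gamma> \<circ> \<rho>)"
    unfolding integral_curve_def
  proof (intro conjI ballI)
    fix t assume t: "t \<in> {0..T}"
    have "\<rho> ` {0..T} = {a..b}"
      using image_cong[of "{a..b}" "{a..b}" "\<lambda>r. \<rho> (\<tau> r)" "\<lambda>r. r"] \<rho>\<tau>
      by (simp add: img[symmetric] image_image)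
    then have "(\<gamma> has_vector_derivative l (\<rho> t) *\<^sub>R X (\<gamma> (\<rho> t))) (at (\<rho> t) within \<rho> ` {0..T})"
      using deriv[OF \<rho>in[OF t]] by simp
    from vector_diff_chain_within[OF \<rho>[OF t, unfolded has_real_derivative_iff_has_vector_derivative] this]
    show "(\<gamma> \<circ> \<rho> has_vector_derivative X ((\<gamma> \<circ> \<rho>) t)) (at t within {0..T})"
      using pos[OF \<rho>in[OF t]] by simp
  qed (simp add: is_interval_cc)
  moreover have "(\<gamma> \<circ> \<rho>) ` {0..T} \<subseteq> S" using \<rho>in S by auto
  moreover have "(\<gamma> \<circ> \<rho>) 0 = \<gamma> a" "(\<gamma> \<circ> \<rho>) T = \<gamma> b"
    using \<rho>\<tau>[of a] \<rho>\<tau>[of b] \<open>a \<le> b\<close> by (auto simp: \<tau>a T_def)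
  ultimately show ?thesis
    unfolding flows_within_def using \<open>0 \<le> T\<close> by blast
qed

section \<open>Monotonicity along a curve, and uniqueness at an equilibrium\<close>

lemma nondecreasing_on_interval:
  fixes f :: "real \<Rightarrow> real"
  assumes "is_interval J"
    and "\<And>t. t \<in> J \<Longrightarrow> (f has_real_derivative f' t) (at t within J)" "\<And>t. t \<in> J \<Longrightarrow> 0 \<le> f' t"
    and "s \<in> J" "t \<in> J" "s \<le> t"
  shows "f s \<le> f t"
proof -
  have sub: "{s..t} \<subseteq> J"
    using assms(1,4,5) unfolding is_interval_1 by (meson atLeastAtMost_iff subsetI)
  have "\<exists>x\<in>{s..t}. f t - f s = (\<lambda>h. f' x * h) (t - s)"
  proof (rule mvt_very_simple[OF \<open>s \<le> t\<close>])
    fix x assume "s \<le> x" "x \<le> t"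
    then show "(f has_derivative (*) (f' x)) (at x within {s..t})"
      using assms(2)[of x] sub unfolding has_field_derivative_def
        by (meson atLeastAtMost_iff has_derivative_subset subsetD)
  qed
  then show ?thesis
    using assms(3,6) sub by (smt (verit) mult_nonneg_nonneg subsetD)
qed

text \<open>Gronwall: the weights \<open>exp (2Kt)\<close> and \<open>exp (-2Kt)\<close> make the squared norm increasing and
  decreasing, respectively.\<close>

lemma integral_curve_through_equilibrium:
  assumes J: "is_interval J" and curve: "integral_curve X J \<phi>"
    and bound: "\<And>t. t \<in> J \<Longrightarrow> norm (X (\<phi> t)) \<le> K * norm (\<phi> t)"
    and "s \<in> J" "t \<in> J" "\<phi> s = 0"
  shows "\<phi> t = 0"
proof -
  define n where "n t = \<phi> t \<bullet> \<phi> t" for t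
  have n: "(n has_real_derivative 2 * (\<phi> t \<bullet> X (\<phi> t))) (at t within J)" if "t \<in> J" for t
  proof -
    have "(\<phi> has_derivative (\<lambda>h. h *\<^sub>R X (\<phi> t))) (at t within J)"
      using curve that by (auto simp: integral_curve_def has_vector_derivative_def)
    from has_derivative_inner[OF this this] show ?thesis
      unfolding n_def has_field_derivative_def by (rule has_derivative_eq_rhs) (auto simp: inner_commute)
  qed
  have abs: "\<bar>\<phi> t \<bullet> X (\<phi> t)\<bar> \<le> K * n t" if "t \<in> J" for t
  proof -
    have "\<bar>\<phi> t \<bullet> X (\<phi> t)\<bar> \<le> norm (\<phi> t) * (K * norm (\<phi> t))"
      using Cauchy_Schwarz_ineq2[of "\<phi> t" "X (\<phi> t)"] mult_left_mono[OF bound[OF that], of "norm (\<phi> t)"] by simp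
    also have "\<dots> = K * n t" by (simp add: n_def dot_square_norm power2_eq_square)
    finally show ?thesis .
  qed
  have E: "n a * exp (2 * K * a) \<le> n b * exp (2 * K * b)"
          "n b * exp (- 2 * K * b) \<le> n a * exp (- 2 * K * a)" if "a \<in> J" "b \<in> J" "a \<le> b" for a b
  proof -
    show "n a * exp (2 * K * a) \<le> n b * exp (2 * K * b)"
    proof (rule nondecreasing_on_interval[OF J _ _ that])
      fix t assume t: "t \<in> J"
      show "((\<lambda>t. n t * exp (2 * K * t)) has_real_derivative
          2 * (K * n t + \<phi> t \<bullet> X (\<phi> t)) * exp (2 * K * t)) (at t within J)"
        by (rule derivative_eq_intros n[OF t] refl | simp add: algebra_simps)+
      show "0 \<le> 2 * (K * n t + \<phi> t \<bullet> X (\<phi> t)) * exp (2 * K * t)"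
        using abs[OF t] by simp
    qed
    have "- (n a * exp (- 2 * K * a)) \<le> - (n b * exp (- 2 * K * b))"
    proof (rule nondecreasing_on_interval[OF J _ _ that])
      fix t assume t: "t \<in> J"
      show "((\<lambda>t. - (n t * exp (- 2 * K * t))) has_real_derivative
          2 * (K * n t - \<phi> t \<bullet> X (\<phi> t)) * exp (- 2 * K * t)) (at t within J)"
        by (rule derivative_eq_intros n[OF t] refl | simp add: algebra_simps)+
      show "0 \<le> 2 * (K * n t - \<phi> t \<bullet> X (\<phi> t)) * exp (- 2 * K * t)"
        using abs[OF t] by simp
    qed
    then show "n b * exp (- 2 * K * b) \<le> n a * exp (- 2 * K * a)" by simp
  qed
  \<comment> \<open>The increasing weighted norm forces \<open>n\<close> to vanish before
    \<open>s\<close>, the decreasing one after \<open>s\<close>.\<close>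
  have "n s = 0" using \<open>\<phi> s = 0\<close> by (simp add: n_def)
  moreover have "n t \<ge> 0" by (simp add: n_def)
  ultimately have "n t = 0"
    using E[of s t] E[of t s] \<open>s \<in> J\<close> \<open>t \<in> J\<close>
    by (cases "s \<le> t") (auto simp: mult_le_0_iff)
  then show ?thesis by (simp add: n_def)
qed

section \<open>Orbits of the model field\<close>

definition cusp_model :: "plane \<Rightarrow> plane" where
  "cusp_model = (\<lambda>(x, y). (y, 3 / 2 * x\<^sup>2))"

definition model_energy :: "plane \<Rightarrow> real" where
  "model_energy q = fst q ^ 3 - (snd q)\<^sup>2"

definition energy_chart :: "real \<Rightarrow> real \<Rightarrow> plane" where
  "energy_chart s y = (root 3 (y\<^sup>2 + s), y)"

text \<open>The common normal form of both flows. The last conjunct breaks the line s = 0 at y = 0: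
  no arc crosses the equilibrium, reaches it or leaves it, and only the resting arc at y = y' = 0
  remains.\<close>

definition orbit_le :: "real \<times> real \<Rightarrow> real \<times> real \<Rightarrow> bool" where
  "orbit_le = (\<lambda>(s, y) (s', y'). s = s' \<and> y \<le> y' \<and> (s = 0 \<and> y \<le> 0 \<and> 0 \<le> y' \<longrightarrow> y = y'))"

lemma root3_cube [simp]: "root 3 x ^ 3 = x"
  by (simp add: odd_real_root_pow)

lemma root3_of_cube [simp]: "root 3 (x ^ 3) = x"
  by (simp add: odd_real_root_power_cancel)

lemma cube_mono: "x \<le> y \<Longrightarrow> x ^ 3 \<le> y ^ 3" for x y :: real
  by (rule power_mono_odd) auto

lemma model_energy_energy_chart [simp]: "model_energy (energy_chart s y) = s"
  by (simp add: model_energy_def energy_chart_def)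

lemma energy_chart_model_energy [simp]: "energy_chart (model_energy q) (snd q) = q"
  by (simp add: model_energy_def energy_chart_def)

lemma snd_energy_chart [simp]: "snd (energy_chart s y) = y"
  by (simp add: energy_chart_def)

lemma integral_curve_has_real_derivative:
  assumes "integral_curve X J \<phi>" "t \<in> J"
  shows "((\<lambda>t. fst (\<phi> t)) has_real_derivative fst (X (\<phi> t))) (at t within J)"
    and "((\<lambda>t. snd (\<phi> t)) has_real_derivative snd (X (\<phi> t))) (at t within J)"
proof -
  have d: "(\<phi> has_derivative (\<lambda>h. h *\<^sub>R X (\<phi> t))) (at t within J)"
    using assms by (auto simp: integral_curve_def has_vector_derivative_def)
  show "((\<lambda>t. fst (\<phi> t)) has_real_derivative fst (X (\<phi> t))) (at t within J)"
    unfolding has_field_derivative_def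
    by (rule has_derivative_eq_rhs[OF has_derivative_fst[OF d]]) (auto simp: mult.commute)
  show "((\<lambda>t. snd (\<phi> t)) has_real_derivative snd (X (\<phi> t))) (at t within J)"
    unfolding has_field_derivative_def
    by (rule has_derivative_eq_rhs[OF has_derivative_snd[OF d]]) (auto simp: mult.commute)
qed

lemma integral_curve_continuous: "integral_curve X J \<phi> \<Longrightarrow> continuous_on J \<phi>"
  unfolding integral_curve_def
  by (auto intro: has_vector_derivative_continuous simp: continuous_on_eq_continuous_within)

lemma integral_curve_subset:
  assumes "integral_curve X J \<phi>" "I \<subseteq> J" "is_interval I"
  shows "integral_curve X I \<phi>"
  using assms unfolding integral_curve_def by (blast intro: has_vector_derivative_within_subset)

section \<open>Arcs respect the order by energy and ordinate\<close>

text \<open>Abstract in the first integral \<open>E\<close> and the nondecreasing function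
  \<open>Y\<close>, so that it serves the saddle and the model alike. On the level
  \<open>E = 0\<close>, a change of sign of \<open>Y\<close> produces a zero of \<open>Y\<close> by
  the intermediate value theorem; the curve is then at the equilibrium, where \<open>K\<close> keeps
  it for all times. The sign of \<open>D\<close> is required on \<open>S\<close> only, because for
  the saddle it holds in the quadrant but not in the plane.\<close>

lemma flows_within_imp_orbit_le:
  assumes flow: "flows_within X S z w"
    and E: "\<And>\<phi> T t. integral_curve X {0..T} \<phi> \<Longrightarrow> t \<in> {0..T} \<Longrightarrow>
      ((\<lambda>t. E (\<phi> t)) has_real_derivative 0) (at t within {0..T})"
    and Y: "\<And>\<phi> T t. integral_curve X {0..T} \<phi> \<Longrightarrow> t \<in> {0..T} \<Longrightarrow>
      ((\<lambda>t. Y (\<phi> t)) has_real_derivative D (\<phi> t)) (at t within {0..T})"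
    and D: "\<And>q. q \<in> S \<Longrightarrow> 0 \<le> D q"
    and K: "\<And>\<phi> s t T. integral_curve X {0..T} \<phi> \<Longrightarrow> s \<in> {0..T} \<Longrightarrow> t \<in> {0..T} \<Longrightarrow> \<phi> s = 0 \<Longrightarrow> \<phi> t = 0"
    and zero: "\<And>q. q \<in> S \<Longrightarrow> E q = 0 \<Longrightarrow> Y q = 0 \<Longrightarrow> q = 0"
  shows "orbit_le (E z, Y z) (E w, Y w)"
proof -
  obtain T \<phi> where T: "0 \<le> T" and \<phi>: "integral_curve X {0..T} \<phi>" "\<phi> ` {0..T} \<subseteq> S" "\<phi> 0 = z" "\<phi> T = w"
    using flow unfolding flows_within_def by blast
  obtain e where e: "\<And>t. t \<in> {0..T} \<Longrightarrow> E (\<phi> t) = e"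
    using has_field_derivative_zero_constant[of "{0..T}" "\<lambda>t. E (\<phi> t)"] E[OF \<phi>(1)] by auto
  have mono: "Y z \<le> Y w"
    using nondecreasing_on_interval[of "{0..T}" "\<lambda>t. Y (\<phi> t)" "\<lambda>t. D (\<phi> t)" 0 T] Y[OF \<phi>(1)] D \<phi> T
    by (auto simp: is_interval_cc image_subset_iff)
  have "Y z = Y w" if e0: "e = 0" and sgn: "Y z \<le> 0" "0 \<le> Y w"
  proof -
    have "continuous_on {0..T} (\<lambda>t. Y (\<phi> t))"
      using Y[OF \<phi>(1)] by (meson DERIV_continuous continuous_on_eq_continuous_within)
    then obtain t where t: "t \<in> {0..T}" "Y (\<phi> t) = 0"
      using IVT'[of "\<lambda>t. Y (\<phi> t)" 0 0 T] sgn T \<phi> by auto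
    then have "\<phi> t = 0" using zero[of "\<phi> t"] \<phi>(2) e e0 t by (auto simp: image_subset_iff)
    then have "\<phi> 0 = 0" "\<phi> T = 0" using K[OF \<phi>(1) t(1)] T by auto
    then show ?thesis using \<phi> by simp
  qed
  then show ?thesis
    using mono e[of 0] e[of T] T \<phi> by (auto simp: orbit_le_def)
qed

lemma cusp_model_energy_derivative:
  assumes "integral_curve cusp_model J \<phi>" "t \<in> J"
  shows "((\<lambda>t. model_energy (\<phi> t)) has_real_derivative 0) (at t within J)"
  unfolding model_energy_def
  by (rule derivative_eq_intros integral_curve_has_real_derivative[OF assms] refl)+
     (simp add: cusp_model_def split_beta)

lemma cusp_model_snd_derivative:
  assumes "integral_curve cusp_model J \<phi>" "t \<in> J"
  shows "((\<lambda>t. snd (\<phi> t)) has_real_derivative 3 / 2 * (fst (\<phi> t))\<^sup>2) (at t within J)"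
  using integral_curve_has_real_derivative(2)[OF assms] by (simp add: cusp_model_def split_beta)

text \<open>The field is quadratic, so the linear bound for Gronwall has no constant valid on the
  whole plane. On the compact time segment between \<open>s\<close> and \<open>t\<close> the curve
  is bounded by some \<open>B\<close>, and 1 + 3/2 B works there.\<close>

lemma cusp_model_through_origin:
  assumes curve: "integral_curve cusp_model J \<phi>" and st: "s \<in> J" "t \<in> J" and "\<phi> s = 0"
  shows "\<phi> t = 0"
proof -
  define I where "I = {min s t..max s t}"
  have sub: "I \<subseteq> J"
  proof (cases "s \<le> t")
    case True
    then show ?thesis
      using curve st unfolding integral_curve_def is_interval_1 I_def max_absorb2[OF True] min_absorb1[OF True]
      by (meson atLeastAtMost_iff subsetI)
  next
    case False
    then have "t \<le> s" by simp
    then show ?thesis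
      using curve st unfolding integral_curve_def is_interval_1 I_def max_absorb1[OF \<open>t \<le> s\<close>] min_absorb2[OF \<open>t \<le> s\<close>]
      by (meson atLeastAtMost_iff subsetI)
  qed
  have I: "integral_curve cusp_model I \<phi>"
    by (rule integral_curve_subset[OF curve sub]) (simp add: I_def is_interval_cc)
  have "bounded (\<phi> ` I)"
    unfolding I_def by (intro compact_imp_bounded compact_continuous_image
        integral_curve_continuous[OF I[unfolded I_def]]) simp
  then obtain B where B: "\<And>t. t \<in> I \<Longrightarrow> norm (\<phi> t) \<le> B"
    unfolding bounded_iff by auto
  have "norm (cusp_model (\<phi> r)) \<le> (1 + 3 / 2 * B) * norm (\<phi> r)" if r: "r \<in> I" for r
  proof -
    obtain x y where q: "\<phi> r = (x, y)" by fastforce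
    have x: "\<bar>x\<bar> \<le> norm (\<phi> r)" and y: "\<bar>y\<bar> \<le> norm (\<phi> r)"
      using norm_fst_le[of x y] norm_snd_le[of y x] by (auto simp: q)
    have "norm (cusp_model (\<phi> r)) \<le> \<bar>y\<bar> + 3 / 2 * (\<bar>x\<bar> * \<bar>x\<bar>)"
      using norm_Pair_le[of y "3 / 2 * x\<^sup>2"] by (simp add: q cusp_model_def power2_eq_square abs_mult)
    also have "\<bar>x\<bar> * \<bar>x\<bar> \<le> B * norm (\<phi> r)"
      using x B[OF r] by (intro mult_mono) auto
    finally show ?thesis using y by (simp add: algebra_simps)
  qed
  then show ?thesis
    using integral_curve_through_equilibrium[OF _ I] \<open>\<phi> s = 0\<close>
    by (metis I I_def atLeastAtMost_iff integral_curve_def max.cobounded1 max.cobounded2 min.cobounded1 min.cobounded2)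
qed

lemma cusp_model_flow_imp_orbit_le:
  assumes "flows_within cusp_model S z w"
  shows "orbit_le (model_energy z, snd z) (model_energy w, snd w)"
  by (rule flows_within_imp_orbit_le[where D = "\<lambda>q. 3 / 2 * (fst q)\<^sup>2", OF assms];
      (rule cusp_model_energy_derivative cusp_model_snd_derivative cusp_model_through_origin; assumption)?)
     (auto simp: model_energy_def zero_prod_def prod_eq_iff)

section \<open>Construction of arcs by regular changes of parameter\<close>

text \<open>Parameter y: the density \<open>l\<close> is dt/dy = 2 / (3 x^2), finite and positive
  exactly off the line x = 0, which is what \<open>nz\<close> expresses.\<close>

lemma cusp_model_flow_ordinate:
  assumes "y1 \<le> y2" and nz: "\<And>y. y \<in> {y1..y2} \<Longrightarrow> y\<^sup>2 + s \<noteq> 0"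
    and S: "\<And>y. y \<in> {y1..y2} \<Longrightarrow> energy_chart s y \<in> S"
  shows "flows_within cusp_model S (energy_chart s y1) (energy_chart s y2)"
proof (rule flows_within_reparametrize[OF \<open>y1 \<le> y2\<close>, where l = "\<lambda>y. 2 / (3 * (root 3 (y\<^sup>2 + s))\<^sup>2)"])
  fix y assume y: "y \<in> {y1..y2}"
  have "((\<lambda>y. root 3 (y\<^sup>2 + s)) has_real_derivative
      2 * y * inverse (3 * (root 3 (y\<^sup>2 + s))\<^sup>2)) (at y within {y1..y2})"
    by (rule derivative_eq_intros DERIV_chain2[where f = "root 3"] DERIV_odd_real_root refl nz[OF y] | simp)+
  from has_vector_derivative_Pair[OF this[unfolded has_real_derivative_iff_has_vector_derivative]
      has_vector_derivative_id]
  show "(energy_chart s has_vector_derivative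
      (2 / (3 * (root 3 (y\<^sup>2 + s))\<^sup>2)) *\<^sub>R cusp_model (energy_chart s y)) (at y within {y1..y2})"
    using nz[OF y] unfolding energy_chart_def[abs_def] cusp_model_def
    by (simp add: field_simps)
next
  show "continuous_on {y1..y2} (\<lambda>y. 2 / (3 * (root 3 (y\<^sup>2 + s))\<^sup>2))"
    using nz by (intro continuous_intros) auto
qed (use nz S in auto)

text \<open>Where y > 0 one has x' = y > 0, so x is a regular parameter with dt/dx = 1 / y; this
  passes through x = 0.\<close>

lemma cusp_model_flow_right:
  assumes "0 < y1" "y1 \<le> y2"
    and S: "\<And>y. y \<in> {y1..y2} \<Longrightarrow> energy_chart s y \<in> S"
  shows "flows_within cusp_model S (energy_chart s y1) (energy_chart s y2)"
proof -
  define x1 x2 where "x1 = root 3 (y1\<^sup>2 + s)" and "x2 = root 3 (y2\<^sup>2 + s)"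
  have "x1 \<le> x2"
    using assms(1,2) by (simp add: x1_def x2_def)
  have bds: "y1\<^sup>2 \<le> x ^ 3 - s" "x ^ 3 - s \<le> y2\<^sup>2" "0 < x ^ 3 - s" if "x \<in> {x1..x2}" for x
  proof -
    show "y1\<^sup>2 \<le> x ^ 3 - s" "x ^ 3 - s \<le> y2\<^sup>2"
      using cube_mono[of x1 x] cube_mono[of x x2] that by (auto simp: x1_def x2_def)
    then show "0 < x ^ 3 - s" using \<open>0 < y1\<close> by (smt (verit) zero_less_power)
  qed
  have "flows_within cusp_model S (x1, sqrt (x1 ^ 3 - s)) (x2, sqrt (x2 ^ 3 - s))"
  proof (rule flows_within_reparametrize[OF \<open>x1 \<le> x2\<close>, where \<gamma> = "\<lambda>x. (x, sqrt (x ^ 3 - s))"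
        and l = "\<lambda>x. 1 / sqrt (x ^ 3 - s)"])
    fix x assume x: "x \<in> {x1..x2}"
    have "((\<lambda>x. sqrt (x ^ 3 - s)) has_real_derivative 3 * x\<^sup>2 * (inverse (sqrt (x ^ 3 - s)) / 2))
        (at x within {x1..x2})"
      using bds[OF x] by (auto intro!: derivative_eq_intros)
    from has_vector_derivative_Pair[OF has_vector_derivative_id
        this[unfolded has_real_derivative_iff_has_vector_derivative]]
    show "((\<lambda>x. (x, sqrt (x ^ 3 - s))) has_vector_derivative
        (1 / sqrt (x ^ 3 - s)) *\<^sub>R cusp_model (x, sqrt (x ^ 3 - s))) (at x within {x1..x2})"
      using bds[OF x] unfolding cusp_model_def by (simp add: field_simps)
  next
    show "continuous_on {x1..x2} (\<lambda>x. 1 / sqrt (x ^ 3 - s))"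
      using bds by (intro continuous_intros) force
  next
    show "(\<lambda>x. (x, sqrt (x ^ 3 - s))) ` {x1..x2} \<subseteq> S"
    proof safe
      fix x assume x: "x \<in> {x1..x2}"
      have "sqrt (x ^ 3 - s) \<in> {y1..y2}"
        using bds[OF x] assms(1,2) by (auto intro: real_le_rsqrt real_le_lsqrt)
      then show "(x, sqrt (x ^ 3 - s)) \<in> S"
        using S[of "sqrt (x ^ 3 - s)"] bds[OF x] by (simp add: energy_chart_def)
    qed
  qed (use bds in force)
  then show ?thesis
    using assms(1,2) by (simp add: x1_def x2_def energy_chart_def)
qed

text \<open>Where y < 0 the abscissa decreases in time, so the increasing parameter is r = -x, with
  dt/dr = -1 / y.\<close>

lemma cusp_model_flow_left:
  assumes "y1 \<le> y2" "y2 < 0"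
    and S: "\<And>y. y \<in> {y1..y2} \<Longrightarrow> energy_chart s y \<in> S"
  shows "flows_within cusp_model S (energy_chart s y1) (energy_chart s y2)"
proof -
  define r1 r2 where "r1 = - root 3 (y1\<^sup>2 + s)" and "r2 = - root 3 (y2\<^sup>2 + s)"
  have sq: "y2\<^sup>2 \<le> y1\<^sup>2"
    using assms(1,2) by (simp add: abs_le_square_iff[symmetric])
  then have "r1 \<le> r2"
    by (simp add: r1_def r2_def)
  have bds: "y2\<^sup>2 \<le> - (r ^ 3) - s" "- (r ^ 3) - s \<le> y1\<^sup>2" "0 < - (r ^ 3) - s" if "r \<in> {r1..r2}" for r
  proof -
    show "y2\<^sup>2 \<le> - (r ^ 3) - s" "- (r ^ 3) - s \<le> y1\<^sup>2"
      using cube_mono[of "r1" r] cube_mono[of r "r2"] that by (auto simp: r1_def r2_def)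
    then show "0 < - (r ^ 3) - s" using \<open>y2 < 0\<close> by (smt (verit) zero_less_power2)
  qed
  have "flows_within cusp_model S (- r1, - sqrt (- (r1 ^ 3) - s)) (- r2, - sqrt (- (r2 ^ 3) - s))"
  proof (rule flows_within_reparametrize[OF \<open>r1 \<le> r2\<close>, where \<gamma> = "\<lambda>r. (- r, - sqrt (- (r ^ 3) - s))"
        and l = "\<lambda>r. 1 / sqrt (- (r ^ 3) - s)"])
    fix r assume r: "r \<in> {r1..r2}"
    have "((\<lambda>r. - sqrt (- (r ^ 3) - s)) has_real_derivative 3 * r\<^sup>2 * (inverse (sqrt (- (r ^ 3) - s)) / 2))
        (at r within {r1..r2})"
      using bds[OF r] by (auto intro!: derivative_eq_intros)
    from has_vector_derivative_Pair[OF has_vector_derivative_minus[OF has_vector_derivative_id]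
        this[unfolded has_real_derivative_iff_has_vector_derivative]]
    show "((\<lambda>r. (- r, - sqrt (- (r ^ 3) - s))) has_vector_derivative
        (1 / sqrt (- (r ^ 3) - s)) *\<^sub>R cusp_model (- r, - sqrt (- (r ^ 3) - s))) (at r within {r1..r2})"
      using bds[OF r] unfolding cusp_model_def by (simp add: field_simps)
  next
    show "continuous_on {r1..r2} (\<lambda>r. 1 / sqrt (- (r ^ 3) - s))"
      using bds by (intro continuous_intros) force
  next
    show "(\<lambda>r. (- r, - sqrt (- (r ^ 3) - s))) ` {r1..r2} \<subseteq> S"
    proof safe
      fix r assume r: "r \<in> {r1..r2}"
      have "sqrt (- (r ^ 3) - s) \<in> {- y2..- y1}"
        using bds[OF r] assms(1,2) by (auto intro: real_le_rsqrt real_le_lsqrt)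
      then show "(- r, - sqrt (- (r ^ 3) - s)) \<in> S"
        using S[of "- sqrt (- (r ^ 3) - s)"] bds[OF r]
        by (simp add: energy_chart_def real_root_minus)
    qed
  qed (use bds in force)
  then show ?thesis
    using assms(1,2) by (simp add: r1_def r2_def energy_chart_def)
qed

text \<open>For \<open>s < 0\<close> the orbit meets the line \<open>x = 0\<close>, on which \<open>y\<close> is not a regular parameter,
  at \<open>y = \<plusminus>\<surd>(-s)\<close>; the arc is cut at \<open>\<plusminus>\<surd>(-s) / 2\<close>.\<close>

lemma cusp_model_flowI:
  assumes le: "orbit_le (s, y1) (s, y2)"
    and S: "\<And>y. y \<in> {y1..y2} \<Longrightarrow> energy_chart s y \<in> S"
  shows "flows_within cusp_model S (energy_chart s y1) (energy_chart s y2)"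
proof (cases "y1 = y2")
  case True
  then show ?thesis using S flows_within_refl by auto
next
  case False
  then have "y1 < y2" and s0: "s = 0 \<Longrightarrow> 0 < y1 \<or> y2 < 0"
    using le by (auto simp: orbit_le_def)
  show ?thesis
  proof (cases "s \<ge> 0")
    case True
    \<comment> \<open>For nonnegative s the sum vanishes only at s = y = 0, and \<open>s0\<close>
      keeps that point off the arc.\<close>
    have "y\<^sup>2 + s \<noteq> 0" if "y \<in> {y1..y2}" for y
      using True s0 that by (auto simp: add_nonneg_eq_0_iff)
    then show ?thesis using cusp_model_flow_ordinate[of y1 y2 s S] S \<open>y1 < y2\<close> by auto
  next
    case False
    define e where "e = sqrt (- s) / 2"
    have "0 < e" and e2: "4 * e\<^sup>2 = - s" using False by (auto simp: e_def power_divide)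
    \<comment> \<open>Clamping the two cuts to the interval from \<open>y1\<close> to
      \<open>y2\<close> treats all positions of the arc at once: a piece that does not occur
      degenerates to a point.\<close>
    define a b where "a = min y2 (max y1 (- e))" and "b = min y2 (max y1 e)"
    have ab: "y1 \<le> a" "a \<le> b" "b \<le> y2" using \<open>y1 < y2\<close> \<open>0 < e\<close> by (auto simp: a_def b_def)
    have refl: "flows_within cusp_model S (energy_chart s y) (energy_chart s y)" if "y \<in> {y1..y2}" for y
      using S[OF that] by (rule flows_within_refl)
    have 1: "flows_within cusp_model S (energy_chart s y1) (energy_chart s a)"
    proof (cases "y1 < - e")
      case True
      then have "a < 0" using \<open>0 < e\<close> by (auto simp: a_def)
      then show ?thesis using cusp_model_flow_left[of y1 a s S] S ab by auto
    next
      case False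
      then have "a = y1" using \<open>y1 < y2\<close> by (auto simp: a_def)
      then show ?thesis using refl[of y1] \<open>y1 < y2\<close> by simp
    qed
    have 2: "flows_within cusp_model S (energy_chart s a) (energy_chart s b)"
    proof (cases "a = b")
      case True
      then show ?thesis using refl[of a] ab by auto
    next
      case ne: False
      \<comment> \<open>An arc that misses the band of ordinates with modulus at most
        \<open>e\<close> has a = b; here the piece lies in the band, and y^2 is at most e^2 = -s/4 <
        -s.\<close>
      have "y\<^sup>2 + s \<noteq> 0" if "y \<in> {a..b}" for y
      proof -
        have "\<bar>y\<bar> \<le> e"
          using that ne \<open>0 < e\<close> \<open>y1 < y2\<close> by (auto simp: a_def b_def min_def max_def split: if_splits)
        then have "y\<^sup>2 \<le> e\<^sup>2" using \<open>0 < e\<close> by (simp add: abs_le_square_iff[symmetric])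
        then show ?thesis using e2 \<open>0 < e\<close> by (smt (verit) zero_less_power)
      qed
      then show ?thesis using cusp_model_flow_ordinate[of a b s S] S ab by auto
    qed
    have 3: "flows_within cusp_model S (energy_chart s b) (energy_chart s y2)"
    proof (cases "e < y2")
      case True
      then have "0 < b" using \<open>0 < e\<close> by (auto simp: b_def)
      then show ?thesis using cusp_model_flow_right[of b y2 s S] S ab by auto
    next
      case False
      then have "b = y2" by (auto simp: b_def)
      then show ?thesis using refl[of y2] \<open>y1 < y2\<close> by simp
    qed
    show ?thesis using 1 2 3 flows_within_trans by blast
  qed
qed

section \<open>Sectors and separatrices\<close>

lemma model_point_eqI:
  assumes "model_energy q = model_energy q'" "snd q = snd q'"
  shows "q = q'"
  by (metis assms energy_chart_model_energy)

section \<open>Orbit arcs of the linear saddle in the unit square\<close>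

text \<open>Since u grows and v shrinks along the explicit solution, bounding u at the final time
  keeps the whole arc in the square.\<close>

lemma saddle_flow_exp:
  assumes "0 \<le> T" and Q: "u \<in> {0..1}" "v \<in> {0..1}" "u * exp T \<le> 1"
  shows "flows_within saddle ({0..1} \<times> {0..1}) (u, v) (u * exp T, v * exp (- T))"
proof -
  define \<phi> where "\<phi> t = (u * exp t, v * exp (- t))" for t
  have "integral_curve saddle {0..T} \<phi>"
    unfolding integral_curve_def
  proof (intro conjI ballI)
    fix t
    have "((\<lambda>t. u * exp t) has_real_derivative u * exp t) (at t within {0..T})"
         "((\<lambda>t. v * exp (- t)) has_real_derivative - (v * exp (- t))) (at t within {0..T})"
      by (auto intro!: derivative_eq_intros)
    then show "(\<phi> has_vector_derivative saddle (\<phi> t)) (at t within {0..T})"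
      unfolding \<phi>_def saddle_def has_real_derivative_iff_has_vector_derivative
      using has_vector_derivative_Pair by fastforce
  qed (simp add: is_interval_cc)
  moreover have "\<phi> ` {0..T} \<subseteq> {0..1} \<times> {0..1}"
  proof
    fix q assume "q \<in> \<phi> ` {0..T}"
    then obtain t where t: "t \<in> {0..T}" "q = \<phi> t" by auto
    have "u * exp t \<le> u * exp T"
      using t Q by (auto intro!: mult_left_mono)
    moreover have "v * exp (- t) \<le> v * 1"
      using t Q by (intro mult_left_mono) auto
    ultimately show "q \<in> {0..1} \<times> {0..1}"
      using t Q by (auto simp: \<phi>_def)
  qed
  ultimately show ?thesis
    unfolding flows_within_def using \<open>0 \<le> T\<close>
    by (intro exI[of _ T] exI[of _ \<phi>]) (auto simp: \<phi>_def)
qed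

text \<open>Along the saddle flow uv is conserved and (u - v)' = u + v, which is nonnegative in the
  quadrant. Conversely the product and the difference determine a point of the quadrant, and the
  time between two related points is an explicit logarithm. The factor \<open>\<epsilon>\<close>
  only relabels the levels, so that both sectors are covered.\<close>

lemma saddle_flow_iff_orbit_le:
  assumes "\<epsilon> \<noteq> 0" and Q: "u \<in> {0..1}" "v \<in> {0..1}" "u' \<in> {0..1}" "v' \<in> {0..1}"
  shows "flows_within saddle ({0..1} \<times> {0..1}) (u, v) (u', v') \<longleftrightarrow>
    orbit_le (\<epsilon> * (u * v), u - v) (\<epsilon> * (u' * v'), u' - v')"
proof
  assume flow: "flows_within saddle ({0..1} \<times> {0..1}) (u, v) (u', v')"
  have "orbit_le (\<epsilon> * (fst (u, v) * snd (u, v)), fst (u, v) - snd (u, v))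
    (\<epsilon> * (fst (u', v') * snd (u', v')), fst (u', v') - snd (u', v'))"
  proof (rule flows_within_imp_orbit_le[OF flow, where D = "\<lambda>q. fst q + snd q"])
    fix \<phi> T t assume *: "integral_curve saddle {0..T} \<phi>" "t \<in> {0..T}"
    show "((\<lambda>t. \<epsilon> * (fst (\<phi> t) * snd (\<phi> t))) has_real_derivative 0) (at t within {0..T})"
      by (rule derivative_eq_intros integral_curve_has_real_derivative[OF *] refl)+
         (simp add: saddle_def split_beta)
    show "((\<lambda>t. fst (\<phi> t) - snd (\<phi> t)) has_real_derivative fst (\<phi> t) + snd (\<phi> t)) (at t within {0..T})"
      by (rule derivative_eq_intros integral_curve_has_real_derivative[OF *] refl)+
         (simp add: saddle_def split_beta)
  next
    fix \<phi> s t T assume *: "integral_curve saddle {0..T} \<phi>" "s \<in> {0..T}" "t \<in> {0..T}" "\<phi> s = 0"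
    show "\<phi> t = 0"
      by (rule integral_curve_through_equilibrium[where K = 1, OF _ *(1) _ *(2-4)])
         (auto simp: is_interval_cc saddle_def split_beta norm_prod_def)
  next
    fix q :: plane assume *: "q \<in> {0..1} \<times> {0..1}" "\<epsilon> * (fst q * snd q) = 0" "fst q - snd q = 0"
    then have "fst q = 0" "snd q = 0"
      using \<open>\<epsilon> \<noteq> 0\<close> by auto
    then show "q = 0" by (simp add: prod_eq_iff)
  qed auto
  then show "orbit_le (\<epsilon> * (u * v), u - v) (\<epsilon> * (u' * v'), u' - v')" by simp
next
  assume "orbit_le (\<epsilon> * (u * v), u - v) (\<epsilon> * (u' * v'), u' - v')"
  then have prod: "u * v = u' * v'" and le: "u - v \<le> u' - v'"
    and sgn: "u * v = 0 \<Longrightarrow> u - v \<le> 0 \<Longrightarrow> 0 \<le> u' - v' \<Longrightarrow> u - v = u' - v'"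
    using \<open>\<epsilon> \<noteq> 0\<close> by (auto simp: orbit_le_def)
  have sum: "u + v = sqrt ((u - v)\<^sup>2 + 4 * (u * v))" "u' + v' = sqrt ((u' - v')\<^sup>2 + 4 * (u' * v'))"
    using Q by (auto intro!: real_sqrt_unique[symmetric] simp: power2_eq_square algebra_simps)
  show "flows_within saddle ({0..1} \<times> {0..1}) (u, v) (u', v')"
  proof (cases "u - v = u' - v'")
    case True
    then have "u + v = u' + v'" using sum prod by simp
    then have "u = u'" "v = v'" using True by linarith+
    then show ?thesis using Q flows_within_refl by auto
  next
    case False
    have uv: "u \<le> u'" "v' \<le> v"
    proof -
      have "u \<le> u' \<and> v' \<le> v"
      proof (rule ccontr)
        \<comment> \<open>By \<open>le\<close>, a move of one coordinate in the wrong direction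
          drags the other along: both decrease or both increase, and the product changes.\<close>
        assume "\<not> (u \<le> u' \<and> v' \<le> v)"
        then consider "u' < u" "v' < v" | "u < u'" "v < v'"
          using le False by linarith
        then show False
        proof cases
          case 1
          then have "u' * v' < u * v" using Q by (intro mult_strict_mono') auto
          then show False using prod by simp
        next
          case 2
          then have "u * v < u' * v'" using Q by (intro mult_strict_mono') auto
          then show False using prod by simp
        qed
      qed
      then show "u \<le> u'" "v' \<le> v" by auto
    qed
    show ?thesis
    proof (cases "u = 0")
      case True
      \<comment> \<open>The start lies on the incoming axis. By \<open>sgn\<close> the end still has
        u' < v', so the vanishing product forces u' = 0, and the time is read off from v instead of
        u.\<close>
      then have "u' = 0" "0 < v'"
        using prod sgn False Q uv le by (auto simp: less_le)
      define T where "T = ln (v / v')"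
      have "0 \<le> T" "exp (- T) = v' / v"
        using \<open>0 < v'\<close> uv by (auto simp: T_def exp_minus)
      then show ?thesis
        using saddle_flow_exp[of T u v] Q True \<open>u' = 0\<close> \<open>0 < v'\<close> uv by simp
    next
      case u: False
      define T where "T = ln (u' / u)"
      have "0 < u" using u Q by auto
      then have "0 \<le> T" "exp T = u' / u" and T: "exp (- T) = u / u'"
        using uv by (auto simp: T_def exp_minus)
      moreover have "v * exp (- T) = v'"
        using prod \<open>0 < u\<close> uv unfolding T by (simp add: field_simps)
      ultimately show ?thesis
        using saddle_flow_exp[of T u v] Q \<open>0 < u\<close> by simp
    qed
  qed
qed

text \<open>In the coordinates \<open>s = \<epsilon>uv\<close>, \<open>y = u - v\<close> the unit square becomes \<open>0 \<le> \<epsilon>s\<close>,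
  \<open>\<epsilon>s + \<bar>y\<bar> \<le> 1\<close>, since \<open>1 - \<epsilon>s - \<bar>y\<bar>\<close> is the smaller of \<open>(1 - u) (1 + v)\<close> and
  \<open>(1 + u) (1 - v)\<close>.\<close>

definition cusp_sector :: "real \<Rightarrow> plane set" where
  "cusp_sector \<epsilon> = {q. 0 \<le> \<epsilon> * model_energy q \<and> \<epsilon> * model_energy q + \<bar>snd q\<bar> \<le> 1}"

section \<open>The two sectors of the model\<close>

text \<open>The inverse solves uv = \<epsilon>s and u - v = y in the quadrant: the sum u + v is the
  nonnegative root of y^2 + 4\<epsilon>s. As \<open>\<epsilon>\<close> is its own inverse,
  \<epsilon>s recovers uv.\<close>

lemma cusp_sector_homeomorphism:
  assumes "\<epsilon> = 1 \<or> \<epsilon> = - 1"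
  shows "homeomorphism ({0..1} \<times> {0..1}) (cusp_sector \<epsilon>)
    (\<lambda>(u, v). energy_chart (\<epsilon> * (u * v)) (u - v))
    (\<lambda>q. ((sqrt ((snd q)\<^sup>2 + 4 * (\<epsilon> * model_energy q)) + snd q) / 2,
          (sqrt ((snd q)\<^sup>2 + 4 * (\<epsilon> * model_energy q)) - snd q) / 2))"
    (is "homeomorphism _ _ ?h ?k")
proof (rule homeomorphismI)
  have [simp]: "\<epsilon> * (\<epsilon> * x) = x" for x using assms by auto
  show "continuous_on ({0..1} \<times> {0..1}) ?h"
    unfolding energy_chart_def split_beta by (intro continuous_intros)
  show "continuous_on (cusp_sector \<epsilon>) ?k"
    unfolding model_energy_def by (intro continuous_intros) auto
  show "?h ` ({0..1} \<times> {0..1}) \<subseteq> cusp_sector \<epsilon>"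
  proof (rule image_subsetI)
    fix z :: plane assume "z \<in> {0..1} \<times> {0..1}"
    then obtain u v where z: "z = (u, v)" "u \<in> {0..1}" "v \<in> {0..1}" by blast
    then have "0 \<le> (1 - u) * (1 + v)" "0 \<le> (1 + u) * (1 - v)" "0 \<le> u * v" by auto
    then show "?h z \<in> cusp_sector \<epsilon>"
      unfolding cusp_sector_def z by (auto simp: algebra_simps abs_le_iff)
  qed
  show "?k (?h z) = z" if "z \<in> {0..1} \<times> {0..1}" for z
  proof -
    obtain u v where z: "z = (u, v)" by fastforce
    have "sqrt ((u - v)\<^sup>2 + 4 * (u * v)) = u + v"
      using that by (auto intro!: real_sqrt_unique simp: z power2_eq_square algebra_simps)
    then show ?thesis by (simp add: z)
  qed
  show "?k ` cusp_sector \<epsilon> \<subseteq> {0..1} \<times> {0..1}"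
  proof (rule image_subsetI)
    fix q assume "q \<in> cusp_sector \<epsilon>"
    then have p: "0 \<le> \<epsilon> * model_energy q" "\<epsilon> * model_energy q + snd q \<le> 1" "\<epsilon> * model_energy q - snd q \<le> 1"
      unfolding cusp_sector_def by auto
    have "\<bar>snd q\<bar> \<le> sqrt ((snd q)\<^sup>2 + 4 * (\<epsilon> * model_energy q))"
      using p by (auto intro!: real_le_rsqrt)
    \<comment> \<open>These are u \<le> 1 and v \<le> 1; squared, they become \<epsilon>s + y \<le>
      1 and \<epsilon>s - y \<le> 1.\<close>
    moreover have "sqrt ((snd q)\<^sup>2 + 4 * (\<epsilon> * model_energy q)) \<le> 2 - snd q"
                  "sqrt ((snd q)\<^sup>2 + 4 * (\<epsilon> * model_energy q)) \<le> 2 + snd q"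
      using p by (intro real_le_lsqrt; simp add: power2_eq_square algebra_simps)+
    ultimately show "?k q \<in> {0..1} \<times> {0..1}" by auto
  qed
  show "?h (?k q) = q" if "q \<in> cusp_sector \<epsilon>" for q
  proof -
    define r where "r = sqrt ((snd q)\<^sup>2 + 4 * (\<epsilon> * model_energy q))"
    have "r * r = (snd q)\<^sup>2 + 4 * (\<epsilon> * model_energy q)"
      using that unfolding r_def cusp_sector_def by auto
    then have "(r + snd q) / 2 * ((r - snd q) / 2) = \<epsilon> * model_energy q"
      by (simp add: algebra_simps power2_eq_square)
    moreover have "(r + snd q) / 2 - (r - snd q) / 2 = snd q" by (simp add: field_simps)
    ultimately show ?thesis
      unfolding r_def[symmetric] by simp
  qed
qed

text \<open>Both flows induce \<open>orbit_le\<close> in the coordinates (s, y). The axes u = 0 and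
  v = 0 go to the halves y < 0 and y > 0 of the curve s = 0 whatever the sign of
  \<open>\<epsilon>\<close>, so the two sectors share their boundary separatrices.\<close>

lemma cusp_sector_hyperbolic:
  assumes eps: "\<epsilon> = 1 \<or> \<epsilon> = - 1"
  shows "hyperbolic_sector cusp_model (0, 0) (cusp_sector \<epsilon>)
    {q. model_energy q = 0 \<and> snd q \<in> {-1..<0}} {q. model_energy q = 0 \<and> snd q \<in> {0<..1}}"
proof -
  let ?h = "\<lambda>(u, v). energy_chart (\<epsilon> * (u * v)) (u - v)"
  have "flows_within saddle ({0..1} \<times> {0..1}) z w \<longleftrightarrow>
      flows_within cusp_model (cusp_sector \<epsilon>) (?h z) (?h w)"
    if zw: "z \<in> {0..1} \<times> {0..1}" "w \<in> {0..1} \<times> {0..1}" for z w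
  proof -
    obtain u v u' v' where zw_eq [simp]: "z = (u, v)" "w = (u', v')" by fastforce
    have Q: "u \<in> {0..1}" "v \<in> {0..1}" "u' \<in> {0..1}" "v' \<in> {0..1}" using zw by auto
    have iff: "flows_within saddle ({0..1} \<times> {0..1}) z w \<longleftrightarrow>
        orbit_le (\<epsilon> * (u * v), u - v) (\<epsilon> * (u' * v'), u' - v')"
      using saddle_flow_iff_orbit_le[OF _ Q, of \<epsilon>] eps by auto
    have "flows_within cusp_model (cusp_sector \<epsilon>) (?h z) (?h w)"
      if le: "orbit_le (\<epsilon> * (u * v), u - v) (\<epsilon> * (u' * v'), u' - v')"
    proof -
      have s: "\<epsilon> * (u * v) = \<epsilon> * (u' * v')" using le by (simp add: orbit_le_def)
      have mem: "?h z \<in> cusp_sector \<epsilon>" "?h w \<in> cusp_sector \<epsilon>"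
        using cusp_sector_homeomorphism[OF eps] zw unfolding homeomorphism_def by blast+
      \<comment> \<open>At a fixed level the sector is an interval in y, hence contains the arc
        between any two of its points.\<close>
      have "energy_chart (\<epsilon> * (u * v)) y \<in> cusp_sector \<epsilon>" if "y \<in> {u - v..u' - v'}" for y
        using mem that s by (auto simp: cusp_sector_def)
      then have "flows_within cusp_model (cusp_sector \<epsilon>)
          (energy_chart (\<epsilon> * (u * v)) (u - v)) (energy_chart (\<epsilon> * (u * v)) (u' - v'))"
        using cusp_model_flowI le[folded s] by blast
      then show ?thesis by (simp only: s zw_eq prod.case)
    qed
    moreover have "orbit_le (\<epsilon> * (u * v), u - v) (\<epsilon> * (u' * v'), u' - v')"
      if "flows_within cusp_model (cusp_sector \<epsilon>) (?h z) (?h w)"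
      using cusp_model_flow_imp_orbit_le[OF that] by simp
    ultimately show ?thesis using iff by blast
  qed
  then have "orbital_equivalence saddle ({0..1} \<times> {0..1}) cusp_model (cusp_sector \<epsilon>) ?h"
    unfolding orbital_equivalence_def using cusp_sector_homeomorphism[OF eps] by blast
  moreover have "?h (0, 0) = (0, 0)" by (simp add: energy_chart_def)
  moreover have "?h ` ({0} \<times> {0<..1}) = {q. model_energy q = 0 \<and> snd q \<in> {-1..<0}}"
  proof (intro subset_antisym subsetI)
    fix q :: plane assume "q \<in> {q. model_energy q = 0 \<and> snd q \<in> {-1..<0}}"
    then have "q = ?h (0, - snd q)" "(0, - snd q) \<in> {0} \<times> {0<..1}"
      using energy_chart_model_energy[of q] by auto
    then show "q \<in> ?h ` ({0} \<times> {0<..1})" by blast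
  qed auto
  moreover have "?h ` ({0<..1} \<times> {0}) = {q. model_energy q = 0 \<and> snd q \<in> {0<..1}}"
  proof (intro subset_antisym subsetI)
    fix q :: plane assume "q \<in> {q. model_energy q = 0 \<and> snd q \<in> {0<..1}}"
    then have "q = ?h (snd q, 0)" "(snd q, 0) \<in> {0<..1} \<times> {0}"
      using energy_chart_model_energy[of q] by auto
    then show "q \<in> ?h ` ({0<..1} \<times> {0})" by blast
  qed auto
  ultimately show ?thesis
    unfolding hyperbolic_sector_def by blast
qed

lemma cusp_sector_Int: "cusp_sector 1 \<inter> cusp_sector (- 1) =
  {(0, 0)} \<union> {q. model_energy q = 0 \<and> snd q \<in> {-1..<0}} \<union> {q. model_energy q = 0 \<and> snd q \<in> {0<..1}}"
  (is "_ = ?R")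
proof (intro subset_antisym subsetI)
  fix q assume "q \<in> cusp_sector 1 \<inter> cusp_sector (- 1)"
  then have q: "model_energy q = 0" "\<bar>snd q\<bar> \<le> 1" by (auto simp: cusp_sector_def)
  then have "q = (0, 0)" if "snd q = 0"
    using model_point_eqI[of q "(0, 0)"] that by (simp add: model_energy_def)
  then show "q \<in> ?R" using q by (auto simp: less_le)
qed (auto simp: cusp_sector_def model_energy_def)

lemma cusp_sector_Un_interior: "(0, 0) \<in> interior (cusp_sector 1 \<union> cusp_sector (- 1))"
proof (rule interiorI)
  show "open {q :: plane. \<bar>model_energy q\<bar> + \<bar>snd q\<bar> < 1}"
    unfolding model_energy_def by (intro open_Collect_less continuous_intros)
qed (auto simp: cusp_sector_def model_energy_def)

section \<open>Orbits tending to the equilibrium, and their tangent direction\<close>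

text \<open>The energy is constant along the orbit and tends to its value 0 at the origin, so it is
  0. The ordinate is nondecreasing with limit 0, hence never positive, and on the zero level y = 0
  would mean the origin itself.\<close>

lemma cusp_model_incoming_orbit:
  assumes \<phi>: "integral_curve cusp_model {0..} \<phi>" and nz: "\<And>t. t \<ge> 0 \<Longrightarrow> \<phi> t \<noteq> 0"
    and lim: "(\<phi> \<longlongrightarrow> 0) at_top"
  shows "\<forall>\<^sub>F t in at_top. \<phi> t \<in> {q. model_energy q = 0 \<and> snd q \<in> {-1..<0}}"
proof -
  obtain e where e: "\<And>t. t \<in> {0..} \<Longrightarrow> model_energy (\<phi> t) = e"
    using has_field_derivative_zero_constant[of "{0..}" "\<lambda>t. model_energy (\<phi> t)"]
      cusp_model_energy_derivative[OF \<phi>] by auto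
  have "((\<lambda>t. model_energy (\<phi> t)) \<longlongrightarrow> fst (0 :: plane) ^ 3 - (snd (0 :: plane))\<^sup>2) at_top"
    unfolding model_energy_def by (intro tendsto_intros lim)
  moreover have "((\<lambda>t. model_energy (\<phi> t)) \<longlongrightarrow> e) at_top"
    by (rule tendsto_eventually, rule eventually_mono[OF eventually_ge_at_top[of 0]]) (use e in simp)
  ultimately have "e = 0"
    using tendsto_unique[OF trivial_limit_at_top_linorder] by fastforce
  have snd_lim: "((\<lambda>t. snd (\<phi> t)) \<longlongrightarrow> 0) at_top"
    using tendsto_snd[OF lim] by simp
  have neg: "snd (\<phi> t) < 0" if "t \<ge> 0" for t
  proof -
    have "snd (\<phi> t) \<le> snd (\<phi> s)" if "t \<le> s" for s
      by (rule nondecreasing_on_interval[where J = "{0..}" and f' = "\<lambda>t. 3 / 2 * (fst (\<phi> t))\<^sup>2"])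
         (use cusp_model_snd_derivative[OF \<phi>] that \<open>t \<ge> 0\<close> in auto)
    then have "\<forall>\<^sub>F s in at_top. snd (\<phi> t) \<le> snd (\<phi> s)"
      by (rule eventually_mono[OF eventually_ge_at_top])
    then have "snd (\<phi> t) \<le> 0"
      using tendsto_lowerbound[OF snd_lim] by simp
    moreover have "snd (\<phi> t) \<noteq> 0"
      using model_point_eqI[of "\<phi> t" 0] e[of t] \<open>e = 0\<close> nz[OF that] that by (auto simp: model_energy_def)
    ultimately show ?thesis by simp
  qed
  have "\<forall>\<^sub>F t in at_top. - 1 < snd (\<phi> t)"
    using order_tendstoD(1)[OF snd_lim, of "- 1"] by simp
  then show ?thesis
    using eventually_ge_at_top[of 0]
    by eventually_elim (use e neg \<open>e = 0\<close> in auto)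
qed

text \<open>Backwards in time the nondecreasing ordinate starts from the limit 0, which makes it
  positive on the zero energy level.\<close>

lemma cusp_model_outgoing_orbit:
  assumes \<phi>: "integral_curve cusp_model {..0} \<phi>" and nz: "\<And>t. t \<le> 0 \<Longrightarrow> \<phi> t \<noteq> 0"
    and lim: "(\<phi> \<longlongrightarrow> 0) at_bot"
  shows "\<forall>\<^sub>F t in at_bot. \<phi> t \<in> {q. model_energy q = 0 \<and> snd q \<in> {0<..1}}"
proof -
  obtain e where e: "\<And>t. t \<in> {..0} \<Longrightarrow> model_energy (\<phi> t) = e"
    using has_field_derivative_zero_constant[of "{..0}" "\<lambda>t. model_energy (\<phi> t)"]
      cusp_model_energy_derivative[OF \<phi>] by auto
  have "((\<lambda>t. model_energy (\<phi> t)) \<longlongrightarrow> fst (0 :: plane) ^ 3 - (snd (0 :: plane))\<^sup>2) at_bot"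
    unfolding model_energy_def by (intro tendsto_intros lim)
  moreover have "((\<lambda>t. model_energy (\<phi> t)) \<longlongrightarrow> e) at_bot"
    by (rule tendsto_eventually, rule eventually_mono[OF eventually_le_at_bot[of 0]]) (use e in simp)
  ultimately have "e = 0"
    using tendsto_unique[OF trivial_limit_at_bot_linorder] by fastforce
  have snd_lim: "((\<lambda>t. snd (\<phi> t)) \<longlongrightarrow> 0) at_bot"
    using tendsto_snd[OF lim] by simp
  have pos: "0 < snd (\<phi> t)" if "t \<le> 0" for t
  proof -
    have "snd (\<phi> s) \<le> snd (\<phi> t)" if "s \<le> t" for s
      by (rule nondecreasing_on_interval[where J = "{..0}" and f' = "\<lambda>t. 3 / 2 * (fst (\<phi> t))\<^sup>2"])
         (use cusp_model_snd_derivative[OF \<phi>] that \<open>t \<le> 0\<close> in auto)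
    then have "\<forall>\<^sub>F s in at_bot. snd (\<phi> s) \<le> snd (\<phi> t)"
      by (rule eventually_mono[OF eventually_le_at_bot])
    then have "0 \<le> snd (\<phi> t)"
      using tendsto_upperbound[OF snd_lim] by simp
    moreover have "snd (\<phi> t) \<noteq> 0"
      using model_point_eqI[of "\<phi> t" 0] e[of t] \<open>e = 0\<close> nz[OF that] that by (auto simp: model_energy_def)
    ultimately show ?thesis by simp
  qed
  have "\<forall>\<^sub>F t in at_bot. snd (\<phi> t) < 1"
    using order_tendstoD(2)[OF snd_lim, of 1] by simp
  then show ?thesis
    using eventually_le_at_bot[of 0]
    by eventually_elim (use e pos \<open>e = 0\<close> in auto)
qed

text \<open>The separatrices are the time translates, through \<open>(1, -1)\<close> and \<open>(1, 1)\<close> at time \<open>0\<close>, of the solution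
  \<open>(4 / t\<^sup>2, -8 / t\<^sup>3)\<close>.\<close>

definition model_in :: "real \<Rightarrow> plane" where
  "model_in t = (4 / (t + 2)\<^sup>2, - 8 / (t + 2) ^ 3)"

definition model_out :: "real \<Rightarrow> plane" where
  "model_out t = (4 / (2 - t)\<^sup>2, 8 / (2 - t) ^ 3)"

lemma model_in_curve: "integral_curve cusp_model {0..} model_in"
  unfolding integral_curve_def
proof (intro conjI ballI)
  fix t :: real assume "t \<in> {0..}"
  then have "t + 2 > 0" by simp
  then have "((\<lambda>t. 4 / (t + 2)\<^sup>2) has_real_derivative - 8 / (t + 2) ^ 3) (at t within {0..})"
       "((\<lambda>t. - 8 / (t + 2) ^ 3) has_real_derivative 3 / 2 * (4 / (t + 2)\<^sup>2)\<^sup>2) (at t within {0..})"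
    by (auto intro!: derivative_eq_intros simp: divide_simps) (auto simp: eval_nat_numeral algebra_simps)
  then show "(model_in has_vector_derivative cusp_model (model_in t)) (at t within {0..})"
    unfolding model_in_def[abs_def] cusp_model_def has_real_derivative_iff_has_vector_derivative
    using has_vector_derivative_Pair by fastforce
qed (simp add: is_interval_ci)

lemma model_out_curve: "integral_curve cusp_model {..0} model_out"
  unfolding integral_curve_def
proof (intro conjI ballI)
  fix t :: real assume "t \<in> {..0}"
  then have "2 - t > 0" by simp
  then have "((\<lambda>t. 4 / (2 - t)\<^sup>2) has_real_derivative 8 / (2 - t) ^ 3) (at t within {..0})"
       "((\<lambda>t. 8 / (2 - t) ^ 3) has_real_derivative 3 / 2 * (4 / (2 - t)\<^sup>2)\<^sup>2) (at t within {..0})"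
    by (auto intro!: derivative_eq_intros simp: divide_simps) (auto simp: eval_nat_numeral algebra_simps)
  then show "(model_out has_vector_derivative cusp_model (model_out t)) (at t within {..0})"
    unfolding model_out_def[abs_def] cusp_model_def has_real_derivative_iff_has_vector_derivative
    using has_vector_derivative_Pair by fastforce
qed (simp add: is_interval_ic)

lemma model_in_image: "model_in ` {0..} = {q. model_energy q = 0 \<and> snd q \<in> {-1..<0}}"
proof (intro subset_antisym subsetI)
  fix q assume "q \<in> model_in ` {0..}"
  then obtain t where t: "0 \<le> t" "q = model_in t" by auto
  have "2 ^ 3 \<le> (t + 2) ^ 3" using t by (intro power_mono) auto
  then show "q \<in> {q. model_energy q = 0 \<and> snd q \<in> {-1..<0}}"
    using t by (auto simp: model_in_def model_energy_def power_divide power_mult[symmetric] field_simps)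
next
  fix q :: plane assume "q \<in> {q. model_energy q = 0 \<and> snd q \<in> {-1..<0}}"
  then have q: "model_energy q = 0" "- 1 \<le> snd q" "snd q < 0" by auto
  \<comment> \<open>The value of t + 2 that solves -8 / (t + 2)^3 = y. It is at least 2, i.e. t
    \<ge> 0, because y \<ge> -1; the abscissa then agrees because both points have energy 0.\<close>
  define r where "r = 2 / root 3 (- snd q)"
  have "0 < root 3 (- snd q)" "root 3 (- snd q) \<le> 1" using q by (auto simp: real_root_le_1_iff)
  then have "2 \<le> r" by (simp add: r_def field_simps)
  have r3: "r ^ 3 = 8 / - snd q" by (simp add: r_def power_divide)
  then have r6: "r ^ 6 = 64 / (snd q)\<^sup>2"
    using power_mult[of r 3 2] by (simp add: power_divide)
  have "model_in (r - 2) = q"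
    by (rule model_point_eqI)
       (use q \<open>2 \<le> r\<close> in \<open>auto simp: model_in_def model_energy_def r3 r6 power_divide power_mult[symmetric]\<close>)
  then show "q \<in> model_in ` {0..}" using \<open>2 \<le> r\<close> by (intro image_eqI[of _ _ "r - 2"]) auto
qed

lemma model_out_image: "model_out ` {..0} = {q. model_energy q = 0 \<and> snd q \<in> {0<..1}}"
proof (intro subset_antisym subsetI)
  fix q assume "q \<in> model_out ` {..0}"
  then obtain t where t: "t \<le> 0" "q = model_out t" by auto
  have "2 ^ 3 \<le> (2 - t) ^ 3" using t by (intro power_mono) auto
  then show "q \<in> {q. model_energy q = 0 \<and> snd q \<in> {0<..1}}"
    using t by (auto simp: model_out_def model_energy_def power_divide power_mult[symmetric] field_simps)
next
  fix q :: plane assume "q \<in> {q. model_energy q = 0 \<and> snd q \<in> {0<..1}}"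
  then have q: "model_energy q = 0" "snd q \<le> 1" "0 < snd q" by auto
  define r where "r = 2 / root 3 (snd q)"
  have "0 < root 3 (snd q)" "root 3 (snd q) \<le> 1" using q by (auto simp: real_root_le_1_iff)
  then have "2 \<le> r" by (simp add: r_def field_simps)
  have r3: "r ^ 3 = 8 / snd q" by (simp add: r_def power_divide)
  then have r6: "r ^ 6 = 64 / (snd q)\<^sup>2"
    using power_mult[of r 3 2] by (simp add: power_divide)
  have "model_out (2 - r) = q"
    by (rule model_point_eqI)
       (use q \<open>2 \<le> r\<close> in \<open>auto simp: model_out_def model_energy_def r3 r6 power_divide power_mult[symmetric]\<close>)
  then show "q \<in> model_out ` {..0}" using \<open>2 \<le> r\<close> by (intro image_eqI[of _ _ "2 - r"]) auto
qed

lemma model_in_tendsto: "(model_in \<longlongrightarrow> (0, 0)) at_top"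
  unfolding model_in_def[abs_def] by (intro tendsto_Pair; real_asymp)

lemma model_out_tendsto: "(model_out \<longlongrightarrow> (0, 0)) at_bot"
  unfolding model_out_def[abs_def] by (intro tendsto_Pair; real_asymp)

text \<open>Up to the positive factor 4 / (t + 2)^2, which \<open>sgn\<close> ignores, the solution
  is (1, -2 / (t + 2)); its limit is nonzero, so \<open>sgn\<close> passes to the limit.\<close>

lemma model_in_tangent: "((\<lambda>t. sgn (model_in t)) \<longlongrightarrow> (1, 0)) at_top"
proof -
  have "((\<lambda>t. (1, - 2 / (t + 2)) :: plane) \<longlongrightarrow> (1, 0)) at_top"
    by (intro tendsto_Pair; real_asymp)
  from tendsto_sgn[OF this] have "((\<lambda>t. sgn ((1, - 2 / (t + 2)) :: plane)) \<longlongrightarrow> (1, 0)) at_top"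
    by (simp add: zero_prod_def sgn_div_norm norm_prod_def)
  moreover have "\<forall>\<^sub>F t in at_top. sgn ((1, - 2 / (t + 2)) :: plane) = sgn (model_in t)"
  proof (rule eventually_mono[OF eventually_ge_at_top[of 0]])
    fix t :: real assume "t \<ge> 0"
    then have "model_in t = (4 / (t + 2)\<^sup>2) *\<^sub>R (1, - 2 / (t + 2))"
      by (simp add: model_in_def eval_nat_numeral)
    then show "sgn ((1, - 2 / (t + 2)) :: plane) = sgn (model_in t)"
      using \<open>t \<ge> 0\<close> by (simp only: sgn_scaleR) simp
  qed
  ultimately show ?thesis by (rule Lim_transform_eventually)
qed

lemma model_out_tangent: "((\<lambda>t. sgn (model_out t)) \<longlongrightarrow> (1, 0)) at_bot"
proof -
  have "((\<lambda>t. (1, 2 / (2 - t)) :: plane) \<longlongrightarrow> (1, 0)) at_bot"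
    by (intro tendsto_Pair; real_asymp)
  from tendsto_sgn[OF this] have "((\<lambda>t. sgn ((1, 2 / (2 - t)) :: plane)) \<longlongrightarrow> (1, 0)) at_bot"
    by (simp add: zero_prod_def sgn_div_norm norm_prod_def)
  moreover have "\<forall>\<^sub>F t in at_bot. sgn ((1, 2 / (2 - t)) :: plane) = sgn (model_out t)"
  proof (rule eventually_mono[OF eventually_le_at_bot[of 0]])
    fix t :: real assume "t \<le> 0"
    then have "model_out t = (4 / (2 - t)\<^sup>2) *\<^sub>R (1, 2 / (2 - t))"
      by (simp add: model_out_def eval_nat_numeral)
    then show "sgn ((1, 2 / (2 - t)) :: plane) = sgn (model_out t)"
      using \<open>t \<le> 0\<close> by (simp only: sgn_scaleR) simp
  qed
  ultimately show ?thesis by (rule Lim_transform_eventually)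
qed

section \<open>Analyticity, and the cusp of the model\<close>

lemma analytic_field_quadratic: "analytic_field (\<lambda>(x, y). (y, k * x\<^sup>2))"
  unfolding analytic_field_def
proof (intro allI)
  fix x0 y0 :: real
  \<comment> \<open>Taylor coefficients at (x0, y0), from k (x0 + u)^2 = k x0^2 + 2 k x0 u + k u^2.
    The sum is finite, so any radius will do.\<close>
  define a :: "nat \<Rightarrow> nat \<Rightarrow> plane" where
    "a i j = (if (i, j) = (0, 0) then (y0, k * x0\<^sup>2) else if (i, j) = (0, 1) then (1, 0)
      else if (i, j) = (1, 0) then (0, 2 * k * x0) else if (i, j) = (2, 0) then (0, k) else 0)" for i j
  have "((\<lambda>(i, j). (u ^ i * v ^ j) *\<^sub>R a i j) has_sum
      (case (x0 + u, y0 + v) of (x, y) \<Rightarrow> (y, k * x\<^sup>2))) UNIV" for u v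
    by (rule has_sum_finite_neutralI[of "{(0, 0), (0, 1), (1, 0), (2, 0)}"])
       (auto simp: a_def power2_eq_square algebra_simps split: if_splits)
  then show "\<exists>a r. 0 < r \<and> (\<forall>u v. \<bar>u\<bar> < r \<and> \<bar>v\<bar> < r \<longrightarrow>
      ((\<lambda>(i, j). (u ^ i * v ^ j) *\<^sub>R a i j) has_sum
        (case (x0 + u, y0 + v) of (x, y) \<Rightarrow> (y, k * x\<^sup>2))) UNIV)"
    using zero_less_one by blast
qed

lemma cusp_cusp_model: "cusp cusp_model (0, 0)"
  unfolding cusp_def
proof (intro conjI exI)
  show "analytic_field cusp_model"
    unfolding cusp_model_def by (rule analytic_field_quadratic)
  show "isolated_critical_point cusp_model (0, 0)"
    unfolding isolated_critical_point_def cusp_model_def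
    by (auto simp: zero_prod_def eventually_at_filter intro!: always_eventually)
  show "integral_curve cusp_model {0..} model_in" "integral_curve cusp_model {..0} model_out"
    by (rule model_in_curve model_out_curve)+
  show "(model_in \<longlongrightarrow> (0, 0)) at_top" "(model_out \<longlongrightarrow> (0, 0)) at_bot"
    by (rule model_in_tendsto model_out_tendsto)+
  show "((\<lambda>t. sgn (model_in t - (0, 0))) \<longlongrightarrow> (1, 0)) at_top"
       "((\<lambda>t. sgn (model_out t - (0, 0))) \<longlongrightarrow> (1, 0)) at_bot"
    using model_in_tangent model_out_tangent by (simp_all flip: zero_prod_def)
  show "hyperbolic_sector cusp_model (0, 0) (cusp_sector 1) (model_in ` {0..}) (model_out ` {..0})"
       "hyperbolic_sector cusp_model (0, 0) (cusp_sector (- 1)) (model_in ` {0..}) (model_out ` {..0})"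
    unfolding model_in_image model_out_image by (rule cusp_sector_hyperbolic, simp)+
  show "cusp_sector 1 \<inter> cusp_sector (- 1) = {(0, 0)} \<union> model_in ` {0..} \<union> model_out ` {..0}"
    unfolding model_in_image model_out_image by (rule cusp_sector_Int)
  show "(0, 0) \<in> interior (cusp_sector 1 \<union> cusp_sector (- 1))"
    by (rule cusp_sector_Un_interior)
  show "\<forall>\<phi>. integral_curve cusp_model {0..} \<phi> \<and> (\<forall>t\<ge>0. \<phi> t \<noteq> (0, 0)) \<and> (\<phi> \<longlongrightarrow> (0, 0)) at_top \<longrightarrow>
      (\<forall>\<^sub>F t in at_top. \<phi> t \<in> model_in ` {0..})"
    unfolding model_in_image zero_prod_def[symmetric] using cusp_model_incoming_orbit by blast
  show "\<forall>\<phi>. integral_curve cusp_model {..0} \<phi> \<and> (\<forall>t\<le>0. \<phi> t \<noteq> (0, 0)) \<and> (\<phi> \<longlongrightarrow> (0, 0)) at_bot \<longrightarrow>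
      (\<forall>\<^sub>F t in at_bot. \<phi> t \<in> model_out ` {..0})"
    unfolding model_out_image zero_prod_def[symmetric] using cusp_model_outgoing_orbit by blast
qed

section \<open>Rescaling\<close>

text \<open>The push-forward of the field under multiplication by \<open>a\<close>. Time is
  unchanged, so solutions map to solutions with the same direction even for negative
  \<open>a\<close>.\<close>

definition rescale_field :: "real \<Rightarrow> (plane \<Rightarrow> plane) \<Rightarrow> plane \<Rightarrow> plane" where
  "rescale_field a X q = a *\<^sub>R X (q /\<^sub>R a)"

lemma rescale_field_inverse:
  assumes "a \<noteq> 0"
  shows "rescale_field (inverse a) (rescale_field a X) = X"
  using assms by (simp add: rescale_field_def fun_eq_iff)

lemma integral_curve_rescale:
  assumes "a \<noteq> 0" "integral_curve X J \<phi>"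
  shows "integral_curve (rescale_field a X) J (\<lambda>t. a *\<^sub>R \<phi> t)"
  using assms unfolding integral_curve_def rescale_field_def
  by (auto intro: bounded_linear.has_vector_derivative[OF bounded_linear_scaleR_right])

lemma integral_curve_unrescale:
  assumes "a \<noteq> 0" "integral_curve (rescale_field a X) J \<phi>"
  shows "integral_curve X J (\<lambda>t. \<phi> t /\<^sub>R a)"
  using integral_curve_rescale[of "inverse a" "rescale_field a X" J \<phi>] assms
  by (simp add: rescale_field_inverse)

lemma flows_within_rescale:
  assumes "a \<noteq> 0" "flows_within X S z w"
  shows "flows_within (rescale_field a X) ((*\<^sub>R) a ` S) (a *\<^sub>R z) (a *\<^sub>R w)"
proof -
  obtain T \<phi> where "0 \<le> T" "integral_curve X {0..T} \<phi>" "\<phi> ` {0..T} \<subseteq> S" "\<phi> 0 = z" "\<phi> T = w"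
    using assms(2) unfolding flows_within_def by blast
  then show ?thesis
    unfolding flows_within_def using integral_curve_rescale[OF \<open>a \<noteq> 0\<close>]
    by (intro exI[of _ T] exI[of _ "\<lambda>t. a *\<^sub>R \<phi> t"]) auto
qed

lemma flows_within_rescale_iff:
  assumes "a \<noteq> 0"
  shows "flows_within (rescale_field a X) ((*\<^sub>R) a ` S) (a *\<^sub>R z) (a *\<^sub>R w) \<longleftrightarrow> flows_within X S z w"
proof
  assume "flows_within (rescale_field a X) ((*\<^sub>R) a ` S) (a *\<^sub>R z) (a *\<^sub>R w)"
  from flows_within_rescale[OF _ this, of "inverse a"] assms show "flows_within X S z w"
    by (simp add: rescale_field_inverse image_image)
qed (rule flows_within_rescale[OF assms])

lemma hyperbolic_sector_rescale:
  assumes "a \<noteq> 0" "hyperbolic_sector X (0, 0) S A B"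
  shows "hyperbolic_sector (rescale_field a X) (0, 0)
    ((*\<^sub>R) a ` S) ((*\<^sub>R) a ` A) ((*\<^sub>R) a ` B)"
proof -
  let ?Q = "{0..1} \<times> {0..1} :: plane set"
  obtain h k where h: "homeomorphism ?Q S h k" "h (0, 0) = (0, 0)"
      "h ` ({0} \<times> {0<..1}) = A" "h ` ({0<..1} \<times> {0}) = B"
    and flow: "\<And>z w. z \<in> ?Q \<Longrightarrow> w \<in> ?Q \<Longrightarrow>
      flows_within saddle ?Q z w \<longleftrightarrow> flows_within X S (h z) (h w)"
    using assms(2) unfolding hyperbolic_sector_def orbital_equivalence_def by blast
  have "homeomorphism S ((*\<^sub>R) a ` S) ((*\<^sub>R) a) ((*\<^sub>R) (inverse a))"
    using \<open>a \<noteq> 0\<close> by (auto simp: homeomorphism_def image_image intro!: continuous_intros)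
  from homeomorphism_compose[OF h(1) this]
  have "orbital_equivalence saddle ?Q (rescale_field a X) ((*\<^sub>R) a ` S) ((*\<^sub>R) a \<circ> h)"
    unfolding orbital_equivalence_def using flow flows_within_rescale_iff[OF \<open>a \<noteq> 0\<close>] by auto
  moreover have "((*\<^sub>R) a \<circ> h) (0, 0) = (0, 0)"
    using h(2) by simp
  ultimately show ?thesis
    unfolding hyperbolic_sector_def
    by (intro exI[of _ "(*\<^sub>R) a \<circ> h"]) (simp add: h(3,4)[symmetric] image_image)
qed

text \<open>Multiplication by \<open>a\<close> is a linear homeomorphism that carries each
  ingredient of the definition along; for the two clauses on other orbits tending to the origin, a
  curve is scaled back first. Analyticity of the new field is taken as a hypothesis: in the
  application that field is an explicit polynomial.\<close>

lemma cusp_rescale: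
  assumes "a \<noteq> 0" "cusp X (0, 0)" "analytic_field (rescale_field a X)"
  shows "cusp (rescale_field a X) (0, 0)"
proof -
  let ?X = "rescale_field a X" and ?s = "(*\<^sub>R) a :: plane \<Rightarrow> plane"
  obtain \<alpha> \<beta> S1 S2 d where crit: "isolated_critical_point X (0, 0)"
    and \<alpha>: "integral_curve X {0..} \<alpha>" "(\<alpha> \<longlongrightarrow> 0) at_top" "((\<lambda>t. sgn (\<alpha> t)) \<longlongrightarrow> d) at_top"
    and \<beta>: "integral_curve X {..0} \<beta>" "(\<beta> \<longlongrightarrow> 0) at_bot" "((\<lambda>t. sgn (\<beta> t)) \<longlongrightarrow> d) at_bot"
    and S: "hyperbolic_sector X (0, 0) S1 (\<alpha> ` {0..}) (\<beta> ` {..0})"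
      "hyperbolic_sector X (0, 0) S2 (\<alpha> ` {0..}) (\<beta> ` {..0})"
    and Int: "S1 \<inter> S2 = {0} \<union> \<alpha> ` {0..} \<union> \<beta> ` {..0}"
    and int: "0 \<in> interior (S1 \<union> S2)"
    and in_orbits: "\<And>\<phi>. integral_curve X {0..} \<phi> \<Longrightarrow> \<forall>t\<ge>0. \<phi> t \<noteq> 0 \<Longrightarrow> (\<phi> \<longlongrightarrow> 0) at_top \<Longrightarrow>
      \<forall>\<^sub>F t in at_top. \<phi> t \<in> \<alpha> ` {0..}"
    and out_orbits: "\<And>\<phi>. integral_curve X {..0} \<phi> \<Longrightarrow> \<forall>t\<le>0. \<phi> t \<noteq> 0 \<Longrightarrow> (\<phi> \<longlongrightarrow> 0) at_bot \<Longrightarrow>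
      \<forall>\<^sub>F t in at_bot. \<phi> t \<in> \<beta> ` {..0}"
    using assms(2) unfolding cusp_def zero_prod_def[symmetric] by (auto 0 0)
  have img: "(\<lambda>t. a *\<^sub>R \<gamma> t) ` I = ?s ` \<gamma> ` I" for \<gamma> :: "real \<Rightarrow> plane" and I by auto
  have inj: "inj ?s" using \<open>a \<noteq> 0\<close> by (auto simp: inj_on_def)
  have crit': "isolated_critical_point ?X 0"
  proof -
    have "filterlim (\<lambda>q. q /\<^sub>R a) (at (0 :: plane)) (at 0)"
      unfolding filterlim_at using \<open>a \<noteq> 0\<close>
      by (auto simp: eventually_at_filter intro!: tendsto_eq_intros always_eventually)
    then have "\<forall>\<^sub>F q in at 0. X (q /\<^sub>R a) \<noteq> 0"
      using crit unfolding isolated_critical_point_def zero_prod_def[symmetric] filterlim_iff by blast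
    then show ?thesis
      using crit \<open>a \<noteq> 0\<close>
      unfolding isolated_critical_point_def zero_prod_def[symmetric] rescale_field_def by simp
  qed
  have member: "q \<in> ?s ` M" if "q /\<^sub>R a \<in> M" for q M
    using that \<open>a \<noteq> 0\<close> by (intro image_eqI[of _ _ "q /\<^sub>R a"]) auto
  show ?thesis
    unfolding cusp_def zero_prod_def[symmetric] diff_zero
  proof (intro conjI exI allI impI; (elim conjE)?)
    show "analytic_field ?X" "isolated_critical_point ?X 0" by fact+
    show "integral_curve ?X {0..} (\<lambda>t. a *\<^sub>R \<alpha> t)" "integral_curve ?X {..0} (\<lambda>t. a *\<^sub>R \<beta> t)"
      using integral_curve_rescale \<open>a \<noteq> 0\<close> \<alpha>(1) \<beta>(1) by blast+
    show "((\<lambda>t. a *\<^sub>R \<alpha> t) \<longlongrightarrow> 0) at_top" "((\<lambda>t. a *\<^sub>R \<beta> t) \<longlongrightarrow> 0) at_bot"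
      using tendsto_scaleR[OF tendsto_const \<alpha>(2), of a] tendsto_scaleR[OF tendsto_const \<beta>(2), of a] by simp_all
    \<comment> \<open>A negative \<open>a\<close> reverses the tangent half-line, but for both
      separatrices alike.\<close>
    show "((\<lambda>t. sgn (a *\<^sub>R \<alpha> t)) \<longlongrightarrow> sgn a *\<^sub>R d) at_top" "((\<lambda>t. sgn (a *\<^sub>R \<beta> t)) \<longlongrightarrow> sgn a *\<^sub>R d) at_bot"
      unfolding sgn_scaleR by (intro tendsto_intros \<alpha> \<beta>)+
    show "hyperbolic_sector ?X 0 (?s ` S1) ((\<lambda>t. a *\<^sub>R \<alpha> t) ` {0..}) ((\<lambda>t. a *\<^sub>R \<beta> t) ` {..0})"
         "hyperbolic_sector ?X 0 (?s ` S2) ((\<lambda>t. a *\<^sub>R \<alpha> t) ` {0..}) ((\<lambda>t. a *\<^sub>R \<beta> t) ` {..0})"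
      unfolding img zero_prod_def by (rule hyperbolic_sector_rescale[OF \<open>a \<noteq> 0\<close>], fact)+
    show "?s ` S1 \<inter> ?s ` S2 = {0} \<union> (\<lambda>t. a *\<^sub>R \<alpha> t) ` {0..} \<union> (\<lambda>t. a *\<^sub>R \<beta> t) ` {..0}"
      unfolding img image_Int[OF inj, symmetric] Int image_Un by simp
    have "open (?s ` interior (S1 \<union> S2))" using \<open>a \<noteq> 0\<close> by (intro open_scaling) auto
    moreover have "?s ` interior (S1 \<union> S2) \<subseteq> ?s ` S1 \<union> ?s ` S2"
      using interior_subset[of "S1 \<union> S2"] by blast
    moreover have "0 \<in> ?s ` interior (S1 \<union> S2)" using int by force
    ultimately show "0 \<in> interior (?s ` S1 \<union> ?s ` S2)" by (meson interiorI)
  next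
    fix \<phi> assume \<phi>: "integral_curve ?X {0..} \<phi>" "\<forall>t\<ge>0. \<phi> t \<noteq> 0" "(\<phi> \<longlongrightarrow> 0) at_top"
    have "((\<lambda>t. \<phi> t /\<^sub>R a) \<longlongrightarrow> 0) at_top"
      using tendsto_scaleR[OF tendsto_const \<phi>(3), of "inverse a"] by simp
    then have "\<forall>\<^sub>F t in at_top. \<phi> t /\<^sub>R a \<in> \<alpha> ` {0..}"
      using in_orbits[OF integral_curve_unrescale[OF \<open>a \<noteq> 0\<close> \<phi>(1)]] \<phi>(2) \<open>a \<noteq> 0\<close> by simp
    then show "\<forall>\<^sub>F t in at_top. \<phi> t \<in> (\<lambda>t. a *\<^sub>R \<alpha> t) ` {0..}"
      unfolding img by (rule eventually_mono) (rule member)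
  next
    fix \<phi> assume \<phi>: "integral_curve ?X {..0} \<phi>" "\<forall>t\<le>0. \<phi> t \<noteq> 0" "(\<phi> \<longlongrightarrow> 0) at_bot"
    have "((\<lambda>t. \<phi> t /\<^sub>R a) \<longlongrightarrow> 0) at_bot"
      using tendsto_scaleR[OF tendsto_const \<phi>(3), of "inverse a"] by simp
    then have "\<forall>\<^sub>F t in at_bot. \<phi> t /\<^sub>R a \<in> \<beta> ` {..0}"
      using out_orbits[OF integral_curve_unrescale[OF \<open>a \<noteq> 0\<close> \<phi>(1)]] \<phi>(2) \<open>a \<noteq> 0\<close> by simp
    then show "\<forall>\<^sub>F t in at_bot. \<phi> t \<in> (\<lambda>t. a *\<^sub>R \<beta> t) ` {..0}"
      unfolding img by (rule eventually_mono) (rule member)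
  qed
qed

theorem proposition4p1:
  fixes c :: real
  assumes "c \<noteq> 0"
  shows "cusp (\<lambda>(x, y). (y, - c * x\<^sup>2)) (0, 0)"
proof -
  \<comment> \<open>Rescaling turns the coefficient 3/2 into 3 / (2a), and 3 / (2a) = -c gives this
    value.\<close>
  define a where "a = - 3 / (2 * c)"
  have "a \<noteq> 0" using assms by (simp add: a_def)
  have "rescale_field a cusp_model = (\<lambda>(x, y). (y, - c * x\<^sup>2))"
    using assms by (auto simp: fun_eq_iff rescale_field_def cusp_model_def a_def power2_eq_square)
  then show ?thesis
    using cusp_rescale[OF \<open>a \<noteq> 0\<close> cusp_cusp_model] analytic_field_quadratic[of "- c"] by simp
qed

end
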